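(* Let $R$ be a commutative ring with unit, let $\mathcal{A}$ be a set (alphabet), and let $L$ be a stable set of words in the alphabet $\mathcal{A}$. Let $\mathcal{P}$ be the graded algebra of phrases formed by non-empty words in the alphabet $\mathcal{A}$, and let $\Delta=\Delta_L:\mathcal{P}\to\mathcal{P}\otimes\mathcal{P}$ be the unique algebra homomorphism such that for every non-empty word $w$, $$\Delta(w)=w\otimes 1+\sum_{c} l_c(w)\otimes r_c(w),$$ where $c$ runs over all cuts of $w$ (including the empty cut). Then the pair $(\mathcal{P},\Delta)$ is a left-handed graded bialgebra with leading term $\rho_L$.
   Context: All tensor products are over $R$. Words. A word of length $m\ge 0$ is a finite sequence $w=w(1)\cdots w(m)$ of elements of $\mathcal{A}$; concatenation is denoted $wx$. For a word $w$ of length $m\ge1$ and $1\le i\le j\le m+1$, $w_{i,j}=w(i)w(i+1)\cdots w(j-1)$ (empty iff $i=j$). A set $L$ of non-empty words is stable if for any word $w$ of length $m\ge1$ and any $1\le i<j\le m+1$ with $(i,j)\ne(1,m+1)$ and $w_{i,j}\in L$, one has $w\in L$ if and only if $w_{1,i}w_{j,m+1}\in L$. $\mathcal{V}$ is the free $R$-module with basis the set of non-empty words. Phrases. A phrase of length $k\ge0$ is a finite sequence $(w_1|w_2|\cdots|w_k)$ of $k$ words; the empty phrase ($k=0$) is denoted $1$. $\mathcal{P}$ is the free $R$-module with basis the phrases all of whose words are non-empty (including $1$), with multiplication given by concatenation of phrases, $(w_1|\cdots|w_k)(x_1|\cdots|x_t)=(w_1|\cdots|w_k|x_1|\cdots|x_t)$;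 it is an associative algebra with unit $1$. It is graded by the length of phrases: $\mathcal{P}=\bigoplus_{k\ge 0}\mathcal{P}^k$. A word $w$ is identified with the one-word phrase $(w)$, so $\mathcal{V}=\mathcal{P}^1$ and $\mathcal{P}=T(\mathcal{V})$ is the tensor algebra of $\mathcal{V}$. Cuts. Let $w$ be a word of length $m\ge1$. A cut of $w$ of length $k\ge0$ is a sequence $c=(i_1,j_1,\ldots,i_k,j_k)$ of $2k$ integers with $1\le i_1<j_1<i_2<j_2<\cdots<i_k<j_k\le m+1$ such that the words $w_{i_1,j_1},\ldots,w_{i_k,j_k}$ all belong to $L$; for $k=1$ one additionally requires $(i_1,j_1)\ne(1,m+1)$. There is a unique cut of length $0$, the empty cut. For a cut $c$ set $l_c(w)=(w_{i_1,j_1}|w_{i_2,j_2}|\cdots|w_{i_k,j_k})\in\mathcal{P}$ and let $r_c(w)$ be the word $w_{1,i_1}w_{j_1,i_2}w_{j_2,i_3}\cdots w_{j_{k-1},i_k}w_{j_k,m+1}$. For the empty cut, $l_c(w)=1$ and $r_c(w)=w$. Map $\rho_L$. $\rho_L:\mathcal{V}\to\mathcal{V}\otimes\mathcal{V}$ is the $R$-linear map with $\rho_L(w)=\sum w_{i,j}\otimes w_{1,i}w_{j,m+1}$ for each word $w$ of length $m\ge1$, where the sum is over all pairs $1\le i<j\le m+1$ with $(i,j)\ne(1,m+1)$ and $w_{i,j}\in L$. Bialgebras. A bialgebra here is a pair $(T,\Delta)$ where $T$ is an associative unital $R$-algebra and $\Delta:T\to T\otimes T$ is an $R$-linear coassociative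 map with $\Delta(1)=1\otimes1$ and $\Delta(ab)=\Delta(a)\Delta(b)$, where $(a\otimes a')(b\otimes b')=ab\otimes a'b'$ in $T\otimes T$; a counit is not required. It is graded if $T=\bigoplus_{m\ge0}T^m$ with $1\in T^0$ and $T^mT^n\subset T^{m+n}$ (no compatibility of $\Delta$ with the grading is required); set $T_+=\bigoplus_{m\ge1}T^m$. A graded bialgebra is left-handed if $\Delta(a)-a\otimes1-1\otimes a\in T_+\otimes T^1$ for all $a\in T^1$. The leading term of $\Delta$ is then $(\pi\otimes\pi)\Delta|_{T^1}:T^1\to T^1\otimes T^1$, where $\pi:T\to T^1$ is the projection. *)

theory Defs
  imports "HOL-Library.Poly_Mapping"
begin

section \<open>Free modules and their tensor products\<close>

text \<open>The sort \<open>{comm_ring, comm_monoid_mult}\<close> is that of commutative rings with unit. Unlike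
  \<open>comm_ring_1\<close> it admits the zero ring. The type \<open>'b \<Rightarrow>\<^sub>0 'r\<close> is the free \<open>'r\<close>-module on \<open>'b\<close>;
  \<open>Poly_Mapping.single x 1\<close> is the basis vector of \<open>x\<close>.\<close>

definition smult :: "'r::{comm_ring,comm_monoid_mult} \<Rightarrow> ('b \<Rightarrow>\<^sub>0 'r) \<Rightarrow> ('b \<Rightarrow>\<^sub>0 'r)" where
  "smult c p = Poly_Mapping.map ((*) c) p"

definition free_mod :: "'b set \<Rightarrow> ('b \<Rightarrow>\<^sub>0 'r::{comm_ring,comm_monoid_mult}) set" where
  "free_mod B = {p. Poly_Mapping.keys p \<subseteq> B}"

definition submodule :: "'b set \<Rightarrow> ('b \<Rightarrow>\<^sub>0 'r::{comm_ring,comm_monoid_mult}) set \<Rightarrow> bool" where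
  "submodule B U \<longleftrightarrow> U \<subseteq> free_mod B \<and> 0 \<in> U \<and>
     (\<forall>p\<in>U. \<forall>q\<in>U. p + q \<in> U) \<and> (\<forall>c. \<forall>p\<in>U. smult c p \<in> U)"

definition linear_map :: "'b set \<Rightarrow> 'c set \<Rightarrow>
    (('b \<Rightarrow>\<^sub>0 'r::{comm_ring,comm_monoid_mult}) \<Rightarrow> ('c \<Rightarrow>\<^sub>0 'r)) \<Rightarrow> bool" where
  "linear_map B C f \<longleftrightarrow>
     (\<forall>p\<in>free_mod B. f p \<in> free_mod C) \<and>
     (\<forall>p\<in>free_mod B. \<forall>q\<in>free_mod B. f (p + q) = f p + f q) \<and>
     (\<forall>c. \<forall>p\<in>free_mod B. f (smult c p) = smult c (f p))"

text \<open>The linear extension of a map defined on the basis.\<close>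

definition lin_ext :: "('b \<Rightarrow> ('c \<Rightarrow>\<^sub>0 'r)) \<Rightarrow> ('b \<Rightarrow>\<^sub>0 'r::{comm_ring,comm_monoid_mult}) \<Rightarrow> ('c \<Rightarrow>\<^sub>0 'r)" where
  "lin_ext f p = (\<Sum>x\<in>Poly_Mapping.keys p. smult (Poly_Mapping.lookup p x) (f x))"

text \<open>The tensor product of the free modules on \<open>B\<close> and \<open>C\<close> is the free module on \<open>B \<times> C\<close>,
  with the canonical bilinear map \<open>tens\<close>; its universal property is lemma
  \<open>tens_universal\<close> below.\<close>

definition tens :: "('b \<Rightarrow>\<^sub>0 'r::{comm_ring,comm_monoid_mult}) \<Rightarrow> ('c \<Rightarrow>\<^sub>0 'r) \<Rightarrow> ('b \<times> 'c \<Rightarrow>\<^sub>0 'r)" where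
  "tens p q = (\<Sum>x\<in>Poly_Mapping.keys p. \<Sum>y\<in>Poly_Mapping.keys q.
     Poly_Mapping.single (x, y) (Poly_Mapping.lookup p x * Poly_Mapping.lookup q y))"

text \<open>The map \<open>f \<otimes> g\<close>, for linear \<open>f\<close> and \<open>g\<close>.\<close>

definition tensor_map :: "(('b \<Rightarrow>\<^sub>0 'r) \<Rightarrow> ('d \<Rightarrow>\<^sub>0 'r)) \<Rightarrow> (('c \<Rightarrow>\<^sub>0 'r) \<Rightarrow> ('e \<Rightarrow>\<^sub>0 'r)) \<Rightarrow>
    ('b \<times> 'c \<Rightarrow>\<^sub>0 'r::{comm_ring,comm_monoid_mult}) \<Rightarrow> ('d \<times> 'e \<Rightarrow>\<^sub>0 'r)" where
  "tensor_map f g = lin_ext (\<lambda>(x, y). tens (f (Poly_Mapping.single x 1)) (g (Poly_Mapping.single y 1)))"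

text \<open>The canonical isomorphism from \<open>(M \<otimes> N) \<otimes> K\<close> to \<open>M \<otimes> (N \<otimes> K)\<close>.\<close>

definition tensor_assoc ::
    "(('b \<times> 'c) \<times> 'd \<Rightarrow>\<^sub>0 'r::{comm_ring,comm_monoid_mult}) \<Rightarrow> ('b \<times> ('c \<times> 'd) \<Rightarrow>\<^sub>0 'r)" where
  "tensor_assoc = lin_ext (\<lambda>((x, y), z). Poly_Mapping.single (x, (y, z)) 1)"

text \<open>The image of \<open>U \<otimes> V\<close> in the tensor product of the ambient modules, for submodules \<open>U\<close>
  and \<open>V\<close>. When these are direct summands, as below, this image is \<open>U \<otimes> V\<close> itself.\<close>

definition tensor_sub :: "('b \<Rightarrow>\<^sub>0 'r::{comm_ring,comm_monoid_mult}) set \<Rightarrow> ('c \<Rightarrow>\<^sub>0 'r) set \<Rightarrow>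
    ('b \<times> 'c \<Rightarrow>\<^sub>0 'r) set" where
  "tensor_sub U V = {\<Sum>i<n. tens (u i) (v i) | (n::nat) u v. (\<forall>i<n. u i \<in> U) \<and> (\<forall>i<n. v i \<in> V)}"

lemma lookup_smult [simp]: "Poly_Mapping.lookup (smult c p) x = c * Poly_Mapping.lookup p x"
  unfolding smult_def by (subst Poly_Mapping.map.rep_eq) (simp add: when_def)

lemma lookup_tens: "Poly_Mapping.lookup (tens p q) (x, y) = Poly_Mapping.lookup p x * Poly_Mapping.lookup q y"
proof -
  have "Poly_Mapping.lookup (tens p q) (x, y) =
    (\<Sum>a\<in>Poly_Mapping.keys p. \<Sum>b\<in>Poly_Mapping.keys q.
      if a = x \<and> b = y then Poly_Mapping.lookup p a * Poly_Mapping.lookup q b else 0)"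
    unfolding tens_def by (simp add: lookup_sum lookup_single when_def)
  also have "\<dots> = (\<Sum>a\<in>Poly_Mapping.keys p. if a = x then
      (\<Sum>b\<in>Poly_Mapping.keys q. if b = y then Poly_Mapping.lookup p a * Poly_Mapping.lookup q b else 0) else 0)"
    by (intro sum.cong) (auto intro: sum.neutral)
  also have "\<dots> = Poly_Mapping.lookup p x * Poly_Mapping.lookup q y"
    by (simp add: in_keys_iff)
  finally show ?thesis .
qed

lemma tens_add_left: "tens (p + p') q = tens p q + tens p' q"
  by (rule poly_mapping_eqI) (clarsimp simp: lookup_tens lookup_add distrib_right)

lemma tens_add_right: "tens p (q + q') = tens p q + tens p q'"
  by (rule poly_mapping_eqI) (clarsimp simp: lookup_tens lookup_add distrib_left)

lemma tens_smult_left: "tens (smult c p) q = smult c (tens p q)"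
  by (rule poly_mapping_eqI) (clarsimp simp: lookup_tens mult.assoc)

lemma tens_smult_right: "tens p (smult c q) = smult c (tens p q)"
  by (rule poly_mapping_eqI) (clarsimp simp: lookup_tens mult.left_commute)

lemma tens_free_mod: "p \<in> free_mod B \<Longrightarrow> q \<in> free_mod C \<Longrightarrow> tens p q \<in> free_mod (B \<times> C)"
  unfolding free_mod_def
  by (auto simp: subset_iff in_keys_iff lookup_tens) (metis mult_zero_left, metis mult_zero_right)

lemma tens_single: "tens (Poly_Mapping.single x a) (Poly_Mapping.single y b) = Poly_Mapping.single (x, y) (a * b)"
  by (rule poly_mapping_eqI) (auto simp: lookup_tens lookup_single when_def split: if_splits)

lemma basis_expansion: "p = (\<Sum>x\<in>Poly_Mapping.keys p. smult (Poly_Mapping.lookup p x) (Poly_Mapping.single x 1))"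
  by (rule poly_mapping_eqI)
     (simp add: lookup_sum lookup_single when_def if_distrib in_keys_iff cong: if_cong)

lemma free_mod_sum_induct [consumes 1, case_names zero add]:
  assumes "p \<in> free_mod B" and "P 0"
    and "\<And>c x p. x \<in> B \<Longrightarrow> p \<in> free_mod B \<Longrightarrow> P p \<Longrightarrow> P (smult c (Poly_Mapping.single x 1) + p)"
  shows "P p"
proof -
  have "P (\<Sum>x\<in>X. smult (Poly_Mapping.lookup p x) (Poly_Mapping.single x 1)) \<and>
      (\<Sum>x\<in>X. smult (Poly_Mapping.lookup p x) (Poly_Mapping.single x 1)) \<in> free_mod B"
    if "finite X" "X \<subseteq> B" for X
    using that
  proof (induction X)
    case empty
    then show ?case using assms(2) by (simp add: free_mod_def)
  next
    case (insert x X)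
    have "Poly_Mapping.keys (smult (Poly_Mapping.lookup p x) (Poly_Mapping.single x 1)) \<subseteq> {x}"
      by (auto simp: in_keys_iff lookup_single when_def split: if_splits)
    then show ?case using insert assms(3)
      by (auto simp: free_mod_def dest!: subsetD[OF keys_add] dest: subsetD)
  qed
  from this[of "Poly_Mapping.keys p"] show ?thesis
    using assms(1) basis_expansion[of p] by (simp add: free_mod_def)
qed

text \<open>Universal property of \<open>tens\<close>: bilinear maps into an arbitrary module with scalar
  multiplication \<open>s\<close> factor uniquely through it.\<close>

lemma tens_universal:
  fixes h :: "('b \<Rightarrow>\<^sub>0 'r::{comm_ring,comm_monoid_mult}) \<Rightarrow> ('c \<Rightarrow>\<^sub>0 'r) \<Rightarrow> 'm::ab_group_add"
    and s :: "'r \<Rightarrow> 'm \<Rightarrow> 'm"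
  assumes s: "\<And>c v w. s c (v + w) = s c v + s c w" "\<And>c d v. s (c + d) v = s c v + s d v"
      "\<And>c d v. s c (s d v) = s (c * d) v" "\<And>v. s 1 v = v"
    and h: "\<And>p p' q. p \<in> free_mod B \<Longrightarrow> p' \<in> free_mod B \<Longrightarrow> q \<in> free_mod C \<Longrightarrow> h (p + p') q = h p q + h p' q"
      "\<And>p q q'. p \<in> free_mod B \<Longrightarrow> q \<in> free_mod C \<Longrightarrow> q' \<in> free_mod C \<Longrightarrow> h p (q + q') = h p q + h p q'"
      "\<And>c p q. p \<in> free_mod B \<Longrightarrow> q \<in> free_mod C \<Longrightarrow> h (smult c p) q = s c (h p q)"
      "\<And>c p q. p \<in> free_mod B \<Longrightarrow> q \<in> free_mod C \<Longrightarrow> h p (smult c q) = s c (h p q)"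
  defines "lin \<equiv> \<lambda>g. (\<forall>u\<in>free_mod (B \<times> C). \<forall>v\<in>free_mod (B \<times> C). g (u + v) = g u + g v) \<and>
      (\<forall>c. \<forall>u\<in>free_mod (B \<times> C). g (smult c u) = s c (g u)) \<and>
      (\<forall>p\<in>free_mod B. \<forall>q\<in>free_mod C. g (tens p q) = h p q)"
  shows "\<exists>g. lin g \<and> (\<forall>g'. lin g' \<longrightarrow> (\<forall>u\<in>free_mod (B \<times> C). g' u = g u))"
proof -
  have s0: "s 0 v = 0" for v using s(2)[of 0 0 v] by simp
  have s0': "s c 0 = 0" for c using s(1)[of c 0 0] by simp
  have fm0: "0 \<in> free_mod X" for X :: "'x set" by (simp add: free_mod_def)
  have fms: "Poly_Mapping.single x 1 \<in> free_mod X" if "x \<in> X" for X :: "'x set" and x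
    using that by (simp add: free_mod_def)
  have fmc: "smult c p \<in> free_mod X" if "p \<in> free_mod X" for X :: "'x set" and c :: 'r and p
    using that by (auto simp: free_mod_def in_keys_iff subset_iff) (metis mult_zero_right)
  let ?e = "\<lambda>z. h (Poly_Mapping.single (fst z) 1) (Poly_Mapping.single (snd z) 1)"
  define g where "g u = (\<Sum>z\<in>Poly_Mapping.keys u. s (Poly_Mapping.lookup u z) (?e z))" for u
  have g_sup: "g u = (\<Sum>z\<in>Z. s (Poly_Mapping.lookup u z) (?e z))"
    if "finite Z" "Poly_Mapping.keys u \<subseteq> Z" for u Z
    unfolding g_def using that by (intro sum.mono_neutral_left) (auto simp: in_keys_iff s0)
  have g_add: "g (u + v) = g u + g v" for u v
  proof -
    let ?Z = "Poly_Mapping.keys u \<union> Poly_Mapping.keys v"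
    have "g (u + v) = (\<Sum>z\<in>?Z. s (Poly_Mapping.lookup (u + v) z) (?e z))"
      by (intro g_sup keys_add) auto
    also have "\<dots> = g u + g v"
      by (simp add: lookup_add s(2) sum.distrib g_sup[of ?Z u] g_sup[of ?Z v])
    finally show ?thesis .
  qed
  have s_sum: "s c (sum f X) = (\<Sum>x\<in>X. s c (f x))" for c X and f :: "('b \<times> 'c) \<Rightarrow> 'm"
    by (induction X rule: infinite_finite_induct) (auto simp: s0' s(1))
  have g_smult: "g (smult c u) = s c (g u)" for c u
  proof -
    have "Poly_Mapping.keys (smult c u) \<subseteq> Poly_Mapping.keys u"
      by (auto simp: in_keys_iff)
    then have "g (smult c u) = (\<Sum>z\<in>Poly_Mapping.keys u. s (Poly_Mapping.lookup (smult c u) z) (?e z))"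
      by (intro g_sup) auto
    then show ?thesis by (simp add: g_def[of u] s_sum s(3))
  qed
  have g0: "g 0 = 0" by (simp add: g_def)
  have h0: "h 0 q = 0" if "q \<in> free_mod C" for q
    using h(1)[OF fm0 fm0 that] by simp
  have h0': "h p 0 = 0" if "p \<in> free_mod B" for p
    using h(2)[OF that fm0 fm0] by simp
  have t0: "tens 0 q = 0" "tens p 0 = 0" for p :: "'b \<Rightarrow>\<^sub>0 'r" and q :: "'c \<Rightarrow>\<^sub>0 'r"
    by (simp_all add: tens_def)
  have ge: "g (Poly_Mapping.single (x, y) 1) = h (Poly_Mapping.single x 1) (Poly_Mapping.single y 1)" for x y
    using g_sup[of "{(x, y)}" "Poly_Mapping.single (x, y) 1"] by (simp add: s(4))
  have g1: "g (tens (Poly_Mapping.single x 1) q) = h (Poly_Mapping.single x 1) q"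
    if x: "x \<in> B" and "q \<in> free_mod C" for x q
    using that(2)
  proof (induction rule: free_mod_sum_induct)
    case zero
    then show ?case using x by (simp add: t0 g0 h0' fms)
  next
    case (add c y q)
    then show ?case using x
      by (simp add: tens_add_right tens_smult_right g_add g_smult tens_single ge h(2,4) fms fmc)
  qed
  have g2: "g (tens p q) = h p q" if "p \<in> free_mod B" and q: "q \<in> free_mod C" for p q
    using that(1)
  proof (induction rule: free_mod_sum_induct)
    case zero
    then show ?case using q by (simp add: t0 g0 h0)
  next
    case (add c x p)
    then show ?case using q
      by (simp add: tens_add_left tens_smult_left g_add g_smult g1 h(1,3) fms fmc)
  qed
  have "lin g" unfolding lin_def by (simp add: g_add g_smult g2)
  moreover have "g' u = g u" if g': "lin g'" and "u \<in> free_mod (B \<times> C)" for g' u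
    using that(2)
  proof (induction rule: free_mod_sum_induct)
    case zero
    have "g' (0 + 0) = g' 0 + g' 0" using g' fm0 unfolding lin_def by blast
    then show ?case by (simp add: g0)
  next
    case (add c z u)
    obtain x y where z: "z = (x, y)" "x \<in> B" "y \<in> C" using add(1) by auto
    have "g' (tens (Poly_Mapping.single x 1) (Poly_Mapping.single y 1)) = ?e z"
      using g' z fms unfolding lin_def by (metis fst_conv snd_conv)
    then have "g' (Poly_Mapping.single z 1) = g (Poly_Mapping.single z 1)"
      by (simp add: tens_single z ge)
    then show ?case using add g' fmc fms unfolding lin_def
      by (metis g_add g_smult)
  qed
  ultimately show ?thesis by blast
qed


section \<open>Bialgebras\<close>

text \<open>The underlying module of \<open>T\<close> is the free module on a set \<open>B\<close>, the multiplication being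
  arbitrary. Bialgebras are not assumed to have a counit.\<close>

definition unital_algebra :: "'b set \<Rightarrow>
    (('b \<Rightarrow>\<^sub>0 'r::{comm_ring,comm_monoid_mult}) \<Rightarrow> ('b \<Rightarrow>\<^sub>0 'r) \<Rightarrow> ('b \<Rightarrow>\<^sub>0 'r)) \<Rightarrow> ('b \<Rightarrow>\<^sub>0 'r) \<Rightarrow> bool" where
  "unital_algebra B mult one \<longleftrightarrow>
     one \<in> free_mod B \<and>
     (\<forall>p\<in>free_mod B. linear_map B B (mult p)) \<and>
     (\<forall>q\<in>free_mod B. linear_map B B (\<lambda>p. mult p q)) \<and>
     (\<forall>p\<in>free_mod B. \<forall>q\<in>free_mod B. \<forall>r\<in>free_mod B. mult (mult p q) r = mult p (mult q r)) \<and>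
     (\<forall>p\<in>free_mod B. mult one p = p \<and> mult p one = p)"

definition algebra_hom :: "'b set \<Rightarrow>
    (('b \<Rightarrow>\<^sub>0 'r::{comm_ring,comm_monoid_mult}) \<Rightarrow> ('b \<Rightarrow>\<^sub>0 'r) \<Rightarrow> ('b \<Rightarrow>\<^sub>0 'r)) \<Rightarrow> ('b \<Rightarrow>\<^sub>0 'r) \<Rightarrow> 'c set \<Rightarrow>
    (('c \<Rightarrow>\<^sub>0 'r) \<Rightarrow> ('c \<Rightarrow>\<^sub>0 'r) \<Rightarrow> ('c \<Rightarrow>\<^sub>0 'r)) \<Rightarrow> ('c \<Rightarrow>\<^sub>0 'r) \<Rightarrow>
    (('b \<Rightarrow>\<^sub>0 'r) \<Rightarrow> ('c \<Rightarrow>\<^sub>0 'r)) \<Rightarrow> bool" where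
  "algebra_hom B mult one C mult' one' f \<longleftrightarrow>
     linear_map B C f \<and> f one = one' \<and>
     (\<forall>p\<in>free_mod B. \<forall>q\<in>free_mod B. f (mult p q) = mult' (f p) (f q))"

text \<open>The bilinear extension of \<open>(a \<otimes> a') (b \<otimes> b') = a b \<otimes> a' b'\<close>.\<close>

definition tensor_mult ::
    "(('b \<Rightarrow>\<^sub>0 'r::{comm_ring,comm_monoid_mult}) \<Rightarrow> ('b \<Rightarrow>\<^sub>0 'r) \<Rightarrow> ('b \<Rightarrow>\<^sub>0 'r)) \<Rightarrow>
    ('b \<times> 'b \<Rightarrow>\<^sub>0 'r) \<Rightarrow> ('b \<times> 'b \<Rightarrow>\<^sub>0 'r) \<Rightarrow> ('b \<times> 'b \<Rightarrow>\<^sub>0 'r)" where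
  "tensor_mult mult u v =
     (\<Sum>(a, a')\<in>Poly_Mapping.keys u. \<Sum>(b, b')\<in>Poly_Mapping.keys v.
        smult (Poly_Mapping.lookup u (a, a') * Poly_Mapping.lookup v (b, b'))
          (tens (mult (Poly_Mapping.single a 1) (Poly_Mapping.single b 1))
                (mult (Poly_Mapping.single a' 1) (Poly_Mapping.single b' 1))))"

definition bialgebra :: "'b set \<Rightarrow>
    (('b \<Rightarrow>\<^sub>0 'r::{comm_ring,comm_monoid_mult}) \<Rightarrow> ('b \<Rightarrow>\<^sub>0 'r) \<Rightarrow> ('b \<Rightarrow>\<^sub>0 'r)) \<Rightarrow> ('b \<Rightarrow>\<^sub>0 'r) \<Rightarrow>
    (('b \<Rightarrow>\<^sub>0 'r) \<Rightarrow> ('b \<times> 'b \<Rightarrow>\<^sub>0 'r)) \<Rightarrow> bool" where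
  "bialgebra B mult one \<Delta> \<longleftrightarrow>
     unital_algebra B mult one \<and>
     algebra_hom B mult one (B \<times> B) (tensor_mult mult) (tens one one) \<Delta> \<and>
     (\<forall>p\<in>free_mod B. tensor_assoc (tensor_map \<Delta> id (\<Delta> p)) = tensor_map id \<Delta> (\<Delta> p))"

text \<open>\<open>f\<close> is a decomposition of \<open>p\<close> into homogeneous components.\<close>

definition decomposes :: "(nat \<Rightarrow> ('b \<Rightarrow>\<^sub>0 'r::{comm_ring,comm_monoid_mult}) set) \<Rightarrow> ('b \<Rightarrow>\<^sub>0 'r) \<Rightarrow>
    (nat \<Rightarrow> ('b \<Rightarrow>\<^sub>0 'r)) \<Rightarrow> bool" where
  "decomposes G p f \<longleftrightarrow> (\<forall>m. f m \<in> G m) \<and> finite {m. f m \<noteq> 0} \<and> p = (\<Sum>m | f m \<noteq> 0. f m)"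

definition graded_bialgebra :: "'b set \<Rightarrow>
    (('b \<Rightarrow>\<^sub>0 'r::{comm_ring,comm_monoid_mult}) \<Rightarrow> ('b \<Rightarrow>\<^sub>0 'r) \<Rightarrow> ('b \<Rightarrow>\<^sub>0 'r)) \<Rightarrow> ('b \<Rightarrow>\<^sub>0 'r) \<Rightarrow>
    (nat \<Rightarrow> ('b \<Rightarrow>\<^sub>0 'r) set) \<Rightarrow> (('b \<Rightarrow>\<^sub>0 'r) \<Rightarrow> ('b \<times> 'b \<Rightarrow>\<^sub>0 'r)) \<Rightarrow> bool" where
  "graded_bialgebra B mult one G \<Delta> \<longleftrightarrow>
     bialgebra B mult one \<Delta> \<and>
     (\<forall>m. submodule B (G m)) \<and>
     (\<forall>p\<in>free_mod B. \<exists>!f. decomposes G p f) \<and>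
     one \<in> G 0 \<and>
     (\<forall>m n. \<forall>p\<in>G m. \<forall>q\<in>G n. mult p q \<in> G (m + n))"

definition component :: "(nat \<Rightarrow> ('b \<Rightarrow>\<^sub>0 'r::{comm_ring,comm_monoid_mult}) set) \<Rightarrow> nat \<Rightarrow>
    ('b \<Rightarrow>\<^sub>0 'r) \<Rightarrow> ('b \<Rightarrow>\<^sub>0 'r)" where
  "component G m p = (THE f. decomposes G p f) m"

definition positive_part :: "(nat \<Rightarrow> ('b \<Rightarrow>\<^sub>0 'r::{comm_ring,comm_monoid_mult}) set) \<Rightarrow> ('b \<Rightarrow>\<^sub>0 'r) set" where
  "positive_part G = {p. \<exists>f. decomposes G p f \<and> f 0 = 0}"

definition left_handed_graded_bialgebra :: "'b set \<Rightarrow>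
    (('b \<Rightarrow>\<^sub>0 'r::{comm_ring,comm_monoid_mult}) \<Rightarrow> ('b \<Rightarrow>\<^sub>0 'r) \<Rightarrow> ('b \<Rightarrow>\<^sub>0 'r)) \<Rightarrow> ('b \<Rightarrow>\<^sub>0 'r) \<Rightarrow>
    (nat \<Rightarrow> ('b \<Rightarrow>\<^sub>0 'r) set) \<Rightarrow> (('b \<Rightarrow>\<^sub>0 'r) \<Rightarrow> ('b \<times> 'b \<Rightarrow>\<^sub>0 'r)) \<Rightarrow> bool" where
  "left_handed_graded_bialgebra B mult one G \<Delta> \<longleftrightarrow>
     graded_bialgebra B mult one G \<Delta> \<and>
     (\<forall>a\<in>G 1. \<Delta> a - tens a one - tens one a \<in> tensor_sub (positive_part G) (G 1))"

text \<open>To be applied to elements of \<open>G 1\<close> only.\<close>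

definition leading_term :: "(nat \<Rightarrow> ('b \<Rightarrow>\<^sub>0 'r::{comm_ring,comm_monoid_mult}) set) \<Rightarrow>
    (('b \<Rightarrow>\<^sub>0 'r) \<Rightarrow> ('b \<times> 'b \<Rightarrow>\<^sub>0 'r)) \<Rightarrow> ('b \<Rightarrow>\<^sub>0 'r) \<Rightarrow> ('b \<times> 'b \<Rightarrow>\<^sub>0 'r)" where
  "leading_term G \<Delta> a = tensor_map (component G 1) (component G 1) (\<Delta> a)"


section \<open>Words and phrases\<close>

definition nonempty_words :: "'a set \<Rightarrow> 'a list set" where
  "nonempty_words A = lists A - {[]}"

text \<open>The word \<open>w(i) \<dots> w(j - 1)\<close>, for \<open>1 \<le> i \<le> j \<le> length w + 1\<close>; positions start at 1.\<close>

definition subword :: "'a list \<Rightarrow> nat \<Rightarrow> nat \<Rightarrow> 'a list" where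
  "subword w i j = take (j - i) (drop (i - 1) w)"

definition stable :: "'a set \<Rightarrow> 'a list set \<Rightarrow> bool" where
  "stable A L \<longleftrightarrow> L \<subseteq> nonempty_words A \<and>
     (\<forall>w\<in>nonempty_words A. \<forall>i j.
        1 \<le> i \<and> i < j \<and> j \<le> length w + 1 \<and> (i, j) \<noteq> (1, length w + 1) \<and> subword w i j \<in> L \<longrightarrow>
        (w \<in> L \<longleftrightarrow> subword w 1 i @ subword w j (length w + 1) \<in> L))"

definition phrases :: "'a set \<Rightarrow> 'a list list set" where
  "phrases A = lists (nonempty_words A)"

definition phrase_one :: "'a list list \<Rightarrow>\<^sub>0 'r::{comm_ring,comm_monoid_mult}" where
  "phrase_one = Poly_Mapping.single [] 1"

definition phrase_mult :: "('a list list \<Rightarrow>\<^sub>0 'r::{comm_ring,comm_monoid_mult}) \<Rightarrow>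
    ('a list list \<Rightarrow>\<^sub>0 'r) \<Rightarrow> ('a list list \<Rightarrow>\<^sub>0 'r)" where
  "phrase_mult p q = (\<Sum>x\<in>Poly_Mapping.keys p. \<Sum>y\<in>Poly_Mapping.keys q.
     Poly_Mapping.single (x @ y) (Poly_Mapping.lookup p x * Poly_Mapping.lookup q y))"

definition phrase_grade :: "'a set \<Rightarrow> nat \<Rightarrow> ('a list list \<Rightarrow>\<^sub>0 'r::{comm_ring,comm_monoid_mult}) set" where
  "phrase_grade A k = free_mod {x \<in> phrases A. length x = k}"

text \<open>The identification of the free module on the non-empty words with the span of the
  one-word phrases.\<close>

definition word_embed :: "('a list \<Rightarrow>\<^sub>0 'r::{comm_ring,comm_monoid_mult}) \<Rightarrow> ('a list list \<Rightarrow>\<^sub>0 'r)" where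
  "word_embed = lin_ext (\<lambda>w. Poly_Mapping.single [w] 1)"


section \<open>Cuts and the coproduct\<close>

text \<open>A cut \<open>(i\<^sub>1, j\<^sub>1, \<dots>, i\<^sub>k, j\<^sub>k)\<close> is the list of the pairs \<open>(i\<^sub>1, j\<^sub>1), \<dots>, (i\<^sub>k, j\<^sub>k)\<close>.\<close>

definition cuts :: "'a list set \<Rightarrow> 'a list \<Rightarrow> (nat \<times> nat) list set" where
  "cuts L w = {c.
     sorted_wrt (<) (concat (map (\<lambda>(i, j). [i, j]) c)) \<and>
     (\<forall>(i, j)\<in>set c. 1 \<le> i \<and> j \<le> length w + 1 \<and> subword w i j \<in> L) \<and>
     c \<noteq> [(1, length w + 1)]}"

definition cut_left :: "'a list \<Rightarrow> (nat \<times> nat) list \<Rightarrow> 'a list list" where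
  "cut_left w c = map (\<lambda>(i, j). subword w i j) c"

text \<open>\<open>remainder w s c\<close> is what the cut \<open>c\<close> leaves of \<open>w\<close> from position \<open>s\<close> on.\<close>

fun remainder :: "'a list \<Rightarrow> nat \<Rightarrow> (nat \<times> nat) list \<Rightarrow> 'a list" where
  "remainder w s [] = subword w s (length w + 1)"
| "remainder w s ((i, j) # c) = subword w s i @ remainder w j c"

definition cut_right :: "'a list \<Rightarrow> (nat \<times> nat) list \<Rightarrow> 'a list" where
  "cut_right w c = remainder w 1 c"

definition rho :: "'a list set \<Rightarrow> ('a list \<Rightarrow>\<^sub>0 'r::{comm_ring,comm_monoid_mult}) \<Rightarrow>
    ('a list \<times> 'a list \<Rightarrow>\<^sub>0 'r)" where
  "rho L = lin_ext (\<lambda>w.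
     \<Sum>(i, j) \<in> {(i, j). 1 \<le> i \<and> i < j \<and> j \<le> length w + 1 \<and> (i, j) \<noteq> (1, length w + 1) \<and> subword w i j \<in> L}.
       tens (Poly_Mapping.single (subword w i j) 1)
            (Poly_Mapping.single (subword w 1 i @ subword w j (length w + 1)) 1))"

text \<open>The defining property of \<open>\<Delta>\<^sub>L\<close>: it is an algebra homomorphism with the prescribed values on
  non-empty words.\<close>

definition cut_coproduct :: "'a set \<Rightarrow> 'a list set \<Rightarrow>
    (('a list list \<Rightarrow>\<^sub>0 'r::{comm_ring,comm_monoid_mult}) \<Rightarrow> ('a list list \<times> 'a list list \<Rightarrow>\<^sub>0 'r)) \<Rightarrow> bool" where
  "cut_coproduct A L \<Delta> \<longleftrightarrow>
     algebra_hom (phrases A) phrase_mult phrase_one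
       (phrases A \<times> phrases A) (tensor_mult phrase_mult) (tens phrase_one phrase_one) \<Delta> \<and>
     (\<forall>w\<in>nonempty_words A.
        \<Delta> (Poly_Mapping.single [w] 1) =
          tens (Poly_Mapping.single [w] 1) phrase_one +
          (\<Sum>c\<in>cuts L w. tens (Poly_Mapping.single (cut_left w c) 1) (Poly_Mapping.single [cut_right w c] 1)))"

lemma finite_cuts: "finite (cuts L w)"
proof (rule finite_subset)
  let ?S = "{1..length w + 1} \<times> {1..length w + 1}"
  have lt: "i < j"
    if "sorted_wrt (<) (concat (map (\<lambda>(i, j). [i, j]) c))" "(i, j) \<in> set c"
    for c :: "(nat \<times> nat) list" and i j
    using that by (induction c) (auto simp: sorted_wrt_append)
  have dis: "distinct c" if "sorted_wrt (<) (concat (map (\<lambda>(i, j). [i, j]) c))"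
    for c :: "(nat \<times> nat) list"
    using that
  proof (induction c)
    case (Cons p c)
    obtain i j where p: "p = (i, j)" by (cases p)
    then have "i \<notin> set (concat (map (\<lambda>(i, j). [i, j]) c))" using Cons.prems by auto
    then have "p \<notin> set c" unfolding p by force
    then show ?case using Cons p by auto
  qed simp
  show "cuts L w \<subseteq> {c. set c \<subseteq> ?S \<and> distinct c}"
  proof
    fix c assume c: "c \<in> cuts L w"
    have "i < j \<and> 1 \<le> i \<and> j \<le> length w + 1" if "(i, j) \<in> set c" for i j
      using c that lt[of c i j] by (auto simp: cuts_def)
    moreover have "distinct c" using c dis by (simp add: cuts_def)
    ultimately show "c \<in> {c. set c \<subseteq> ?S \<and> distinct c}" by force
  qed
  show "finite {c. set c \<subseteq> ?S \<and> distinct c}"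
    by (rule finite_subset_distinct) simp
qed

end

theory Submission
  imports Defs
begin

text \<open>A cut of \<open>w\<close> amounts to writing \<open>w\<close> as a list of kept letters and of holes from \<open>L\<close>, no two
  holes being consecutive. Both sides of coassociativity are multiplicative, so only a word \<open>w\<close>
  matters. There \<open>(\<Delta> \<otimes> id) \<Delta>\<close> sums over the cuts of \<open>w\<close> together with a cut of each hole, and
  \<open>(id \<otimes> \<Delta>) \<Delta>\<close> sums over the cuts of \<open>w\<close> together with a cut of the word that is left. Both are
  the same as cuts of \<open>w\<close> with holes that are themselves cut; stability says exactly that such a
  hole lies in \<open>L\<close> if and only if the word left of it does.\<close>

section \<open>Cuts as token lists\<close>

text \<open>Cuts by positions do not compose well: a cut of \<open>r_c(w)\<close> is indexed by the
  positions of another word. Token lists carry the letters themselves, so iterated cuts become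
  recursions on lists, with no index shifts. Two degenerate situations shape the rest. A hole that
  is cut away as a whole leaves the empty word, which no basis phrase may contain;
  \<open>kept_phrase\<close> therefore sends it to the unit, and \<open>w \<otimes> 1\<close>
  becomes the contribution of one extra list, \<open>[Hole w]\<close>. Stability is silent when
  nothing is left, so this case is treated apart: the cut of the hole then is the hole itself.
  Moreover, a hole of the inner cut may touch the end of an outer hole or fill it. To which outer
  hole it belongs must be decided uniquely, and the ban on consecutive holes decides it. The
  bijections are turned into an identity of sums of an arbitrary function of three arguments; linear
  algebra enters only afterwards.\<close>

datatype ('a, 'h) token = Letter 'a | Hole 'h

fun kept :: "('a, 'h) token list \<Rightarrow> 'a list" where
  "kept [] = []"
| "kept (Letter a # x) = a # kept x"
| "kept (Hole h # x) = kept x"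

fun holes :: "('a, 'h) token list \<Rightarrow> 'h list" where
  "holes [] = []"
| "holes (Letter a # x) = holes x"
| "holes (Hole h # x) = h # holes x"

fun flat :: "('a, 'a list) token list \<Rightarrow> 'a list" where
  "flat [] = []"
| "flat (Letter a # x) = a # flat x"
| "flat (Hole h # x) = h @ flat x"

text \<open>The flag tells whether the first token may be a hole.\<close>

fun separated :: "bool \<Rightarrow> ('a, 'h) token list \<Rightarrow> bool" where
  "separated b [] \<longleftrightarrow> True"
| "separated b (Letter a # x) \<longleftrightarrow> separated True x"
| "separated b (Hole h # x) \<longleftrightarrow> b \<and> separated False x"

lemma kept_append [simp]: "kept (x @ y) = kept x @ kept y"
  by (induction x rule: kept.induct) auto

lemma holes_append [simp]: "holes (x @ y) = holes x @ holes y"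
  by (induction x rule: holes.induct) auto

lemma flat_append [simp]: "flat (x @ y) = flat x @ flat y"
  by (induction x rule: flat.induct) auto

lemma kept_map_Letter [simp]: "kept (map Letter u) = u"
  by (induction u) auto

lemma holes_map_Letter [simp]: "holes (map Letter u) = []"
  by (induction u) auto

lemma flat_map_Letter [simp]: "flat (map Letter u) = u"
  by (induction u) auto

lemma separated_map_Letter_append: "separated b (map Letter u @ y) \<longleftrightarrow> separated (b \<or> u \<noteq> []) y"
  by (induction u arbitrary: b) auto

lemma separated_map_Letter [simp]: "separated b (map Letter u)"
  using separated_map_Letter_append[of b u "[]"] by simp

lemma separated_True: "separated b x \<Longrightarrow> separated True x"
  by (cases x rule: holes.cases) auto

lemma separated_appendD: "separated b (x @ y) \<Longrightarrow> separated b x \<and> (\<exists>c. separated c y)"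
  by (induction x arbitrary: b rule: holes.induct) auto

lemma separated_append: "separated True x \<Longrightarrow> separated False y \<Longrightarrow> separated True (x @ y)"
proof -
  have "separated b x \<Longrightarrow> separated False y \<Longrightarrow> separated b (x @ y)" for b
  proof (induction b x rule: separated.induct)
    case (1 b)
    then show ?case by (cases b) (auto intro: separated_True)
  qed auto
  then show "separated True x \<Longrightarrow> separated False y \<Longrightarrow> separated True (x @ y)" .
qed

text \<open>Without letters every token is a hole, and two holes may not be adjacent. This detects
  the degenerate cuts, those that leave nothing.\<close>

lemma kept_Nil_separated: "separated True x \<Longrightarrow> kept x = [] \<Longrightarrow> x = [] \<or> (\<exists>h. x = [Hole h])"
proof (cases x rule: holes.cases)
  case (3 h y)
  then show "separated True x \<Longrightarrow> kept x = [] \<Longrightarrow> ?thesis" by (cases y rule: holes.cases) auto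
qed auto

lemma kept_subset_flat: "set (kept x) \<subseteq> set (flat x)"
  by (induction x rule: flat.induct) auto

lemma nonempty_words_iff: "w \<in> nonempty_words A \<longleftrightarrow> w \<noteq> [] \<and> set w \<subseteq> A"
  by (auto simp: nonempty_words_def)

text \<open>The strict inequality between the end of a block and the start of the next becomes
  \<open>separated\<close>; the flag is \<open>True\<close> because a cut may start with the first
  letter. Excluding \<open>[Hole w]\<close> is excluding the cut \<open>(1, m + 1)\<close>.\<close>

definition cut_tokens :: "'a list set \<Rightarrow> 'a list \<Rightarrow> ('a, 'a list) token list set" where
  "cut_tokens L w = {x. separated True x \<and> set (holes x) \<subseteq> L \<and> flat x = w \<and> x \<noteq> [Hole w]}"

text \<open>The recursion copies that of \<open>remainder\<close>, so that \<open>kept\<close>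
  yields the right factor of a cut and \<open>holes\<close> the left one.\<close>

fun cut_to_tokens :: "'a list \<Rightarrow> nat \<Rightarrow> (nat \<times> nat) list \<Rightarrow> ('a, 'a list) token list" where
  "cut_to_tokens w s [] = map Letter (subword w s (length w + 1))"
| "cut_to_tokens w s ((i, j) # c) = map Letter (subword w s i) @ Hole (subword w i j) # cut_to_tokens w j c"

fun tokens_to_cut :: "nat \<Rightarrow> ('a, 'a list) token list \<Rightarrow> (nat \<times> nat) list" where
  "tokens_to_cut s [] = []"
| "tokens_to_cut s (Letter a # x) = tokens_to_cut (Suc s) x"
| "tokens_to_cut s (Hole h # x) = (s, s + length h) # tokens_to_cut (s + length h) x"

text \<open>The cut condition for the part of \<open>w\<close> from position \<open>s\<close> on, in
  recursive form. The flag allows a block to start at \<open>s\<close> itself and corresponds to the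
  flag of \<open>separated\<close>.\<close>

fun admissible :: "'a list set \<Rightarrow> 'a list \<Rightarrow> bool \<Rightarrow> nat \<Rightarrow> (nat \<times> nat) list \<Rightarrow> bool" where
  "admissible L w b s [] \<longleftrightarrow> True"
| "admissible L w b s ((i, j) # c) \<longleftrightarrow> (if b then s \<le> i else s < i) \<and> i < j \<and> j \<le> length w + 1 \<and>
     subword w i j \<in> L \<and> admissible L w False j c"

lemma holes_cut_to_tokens: "holes (cut_to_tokens w s c) = cut_left w c"
  by (induction w s c rule: cut_to_tokens.induct) (auto simp: cut_left_def)

lemma kept_cut_to_tokens: "kept (cut_to_tokens w s c) = remainder w s c"
  by (induction w s c rule: cut_to_tokens.induct) auto

lemma tokens_to_cut_map_Letter_append:
  "tokens_to_cut s (map Letter u @ y) = tokens_to_cut (s + length u) y"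
  by (induction u arbitrary: s) auto

text \<open>The sentinel in front of the sorted list encodes the bound on the first index:
  \<open>s - 1 < i\<close> means \<open>s \<le> i\<close>, where \<open>1 \<le> s\<close> keeps the
  subtraction on naturals exact.\<close>

lemma admissible_iff_sorted:
  "1 \<le> s \<Longrightarrow> admissible L w b s c \<longleftrightarrow>
    sorted_wrt (<) ((if b then s - 1 else s) # concat (map (\<lambda>(i, j). [i, j]) c)) \<and>
    (\<forall>(i, j)\<in>set c. 1 \<le> i \<and> j \<le> length w + 1 \<and> subword w i j \<in> L)"
proof (induction L w b s c rule: admissible.induct)
  case (2 L w b s i j c)
  let ?rest = "concat (map (\<lambda>(i, j). [i, j]) c)" and ?s = "if b then s - 1 else s"
  let ?Q = "\<lambda>c. \<forall>(i, j)\<in>set c. 1 \<le> i \<and> j \<le> length w + 1 \<and> subword w i j \<in> L"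
  have concat: "concat (map (\<lambda>(i, j). [i, j]) ((i, j) # c)) = i # j # ?rest" by simp
  have sorted: "sorted_wrt (<) (?s # i # j # ?rest) \<longleftrightarrow> ?s < i \<and> i < j \<and> sorted_wrt (<) (j # ?rest)"
    by (simp only: sorted_wrt2[OF transp_on_less])
  have Q: "?Q ((i, j) # c) \<longleftrightarrow> (1 \<le> i \<and> j \<le> length w + 1 \<and> subword w i j \<in> L) \<and> ?Q c"
    by simp
  have le: "?s < i \<longleftrightarrow> (if b then s \<le> i else s < i)" using 2(2) by auto
  show ?case
  proof (cases "?s < i \<and> i < j")
    case True
    then have "1 \<le> j" "1 \<le> i" by simp_all
    from True show ?thesis
      unfolding concat sorted Q admissible.simps 2(1)[OF \<open>1 \<le> j\<close>] le[symmetric] if_False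
      using \<open>1 \<le> i\<close> by blast
  next
    case False
    then show ?thesis unfolding concat sorted admissible.simps le[symmetric] by blast
  qed
qed simp

lemma length_subword: "i \<le> j \<Longrightarrow> 1 \<le> i \<Longrightarrow> j \<le> length w + 1 \<Longrightarrow> length (subword w i j) = j - i"
  by (auto simp: subword_def)

lemma subword_append_drop:
  "s \<le> i \<Longrightarrow> 1 \<le> s \<Longrightarrow> subword w s i @ drop (i - 1) w = drop (s - 1) w"
proof -
  assume "s \<le> i" "1 \<le> s"
  then have "drop (i - 1) w = drop (i - s) (drop (s - 1) w)" by simp
  then show ?thesis by (simp add: subword_def del: drop_drop)
qed

lemma subword_to_end: "1 \<le> s \<Longrightarrow> subword w s (Suc (length w)) = drop (s - 1) w"
  by (simp add: subword_def)

lemma cut_to_tokens_props: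
  assumes "admissible L w b s c" "1 \<le> s" "s \<le> length w + 1"
  shows "separated b (cut_to_tokens w s c) \<and> set (holes (cut_to_tokens w s c)) \<subseteq> L \<and> flat (cut_to_tokens w s c) = drop (s - 1) w \<and>
    tokens_to_cut s (cut_to_tokens w s c) = c"
  using assms
proof (induction L w b s c rule: admissible.induct)
  case (1 L w b s)
  then show ?case
    using tokens_to_cut_map_Letter_append[of s "drop (s - 1) w" "[]"] by (simp add: subword_to_end)
next
  case (2 L w b s i j c)
  then have ij: "s \<le> i" "1 \<le> i" "i < j" "1 \<le> j" "j \<le> length w + 1" by (auto split: if_splits)
  \<comment> \<open>If \<open>b\<close> is false then \<open>s < i\<close>, so some letter stands
    between the previous hole and this one.\<close>
  then have ne: "b \<or> subword w s i \<noteq> []"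
    using 2(2,3) by (auto split: if_splits simp: subword_def)
  have "flat (cut_to_tokens w s ((i, j) # c)) = subword w s i @ (subword w i j @ drop (j - 1) w)"
    using 2 ij by simp
  also have "\<dots> = drop (s - 1) w"
    using ij 2(3) by (simp only: subword_append_drop less_imp_le)
  finally have "flat (cut_to_tokens w s ((i, j) # c)) = drop (s - 1) w" .
  then show ?case
    using 2 ij ne
    by (simp add: separated_map_Letter_append tokens_to_cut_map_Letter_append length_subword)
qed

text \<open>Bridges two recursions: \<open>tokens_to_cut\<close> advances letter by letter, whereas
  \<open>cut_to_tokens\<close> takes all letters before the next hole at once.\<close>

lemma cut_to_tokens_Suc:
  assumes "admissible L w True (Suc s) c" "1 \<le> s" "s \<le> length w"
  shows "cut_to_tokens w s c = Letter (w ! (s - 1)) # cut_to_tokens w (Suc s) c" "admissible L w b s c"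
proof -
  have *: "subword w s i = (w ! (s - 1)) # subword w (Suc s) i" if "Suc s \<le> i" for i
  proof -
    have "drop (s - 1) w = w ! (s - 1) # drop s w"
      using assms(2,3) by (metis Cons_nth_drop_Suc One_nat_def Suc_diff_1 Suc_le_eq)
    moreover have "i - s = Suc (i - Suc s)" using that by simp
    ultimately show ?thesis unfolding subword_def by simp
  qed
  show "cut_to_tokens w s c = Letter (w ! (s - 1)) # cut_to_tokens w (Suc s) c"
  proof (cases c)
    case (Cons p c')
    then show ?thesis using assms *[of "fst p"] by (cases p) auto
  qed (use assms *[of "Suc (length w)"] in auto)
  show "admissible L w b s c"
    using assms by (cases "(L, w, b, s, c)" rule: admissible.cases) auto
qed

text \<open>The word \<open>w\<close> stays fixed while \<open>x\<close> is what remains to be read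
  from position \<open>s\<close>. Since holes are non-empty, each block found satisfies
  \<open>i < j\<close>.\<close>

lemma tokens_to_cut_props:
  assumes "flat x = drop (s - 1) w" "separated b x" "set (holes x) \<subseteq> L" "[] \<notin> L" "1 \<le> s" "s \<le> length w + 1"
  shows "admissible L w b s (tokens_to_cut s x) \<and> cut_to_tokens w s (tokens_to_cut s x) = x"
  using assms
proof (induction s x arbitrary: b rule: tokens_to_cut.induct)
  case (1 s)
  then show ?case by (simp add: subword_to_end)
next
  case (2 s a x)
  then have s: "s \<le> length w" by (cases "s = length w + 1") auto
  then have d: "drop (s - 1) w = w ! (s - 1) # drop s w"
    using 2 by (metis Cons_nth_drop_Suc One_nat_def Suc_diff_1 Suc_le_eq)
  have "admissible L w True (Suc s) (tokens_to_cut (Suc s) x) \<and> cut_to_tokens w (Suc s) (tokens_to_cut (Suc s) x) = x"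
    using 2(1)[of True] 2 s d by simp
  then show ?case using cut_to_tokens_Suc(1)[of L w s] cut_to_tokens_Suc(2)[of L w s _ b] 2 s d by simp
next
  case (3 s h x)
  have h: "h \<noteq> []" "h \<in> L" using 3 by auto
  have len: "length h + length (flat x) = length w - (s - 1)"
    using arg_cong[OF 3(2), of length] by simp
  have d: "flat x = drop (s + length h - 1) w" "subword w s (s + length h) = h"
  proof -
    have "drop (length h) (drop (s - 1) w) = flat x" using 3(2) by (metis append_eq_conv_conj flat.simps(3))
    then show "flat x = drop (s + length h - 1) w" using 3 by (simp add: add.commute)
    show "subword w s (s + length h) = h"
      unfolding subword_def using 3(2) by (metis add_diff_cancel_left' append_eq_conv_conj flat.simps(3))
  qed
  have le: "s + length h \<le> length w + 1" using len 3 h by auto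
  have "admissible L w False (s + length h) (tokens_to_cut (s + length h) x) \<and>
      cut_to_tokens w (s + length h) (tokens_to_cut (s + length h) x) = x"
    by (rule 3(1)) (use 3(3-6) d le in auto)
  moreover have "subword w s s = []" by (simp add: subword_def)
  ultimately show ?case using 3(3) h le d(2) by simp
qed

lemma bij_betw_cut_to_tokens:
  assumes "[] \<notin> L"
  shows "bij_betw (cut_to_tokens w 1) (cuts L w) (cut_tokens L w)"
proof (rule bij_betw_byWitness[where f' = "tokens_to_cut 1"])
  have adm: "c \<in> cuts L w \<longleftrightarrow> admissible L w True 1 c \<and> c \<noteq> [(1, length w + 1)]" for c
  proof -
    \<comment> \<open>For \<open>s = 1\<close> and flag \<open>True\<close> the sentinel is 0, which
      is harmless because positions start at 1.\<close>
    have "sorted_wrt (<) (0 # concat (map (\<lambda>(i, j). [i, j]) c)) \<longleftrightarrow>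
        sorted_wrt (<) (concat (map (\<lambda>(i, j). [i, j]) c))" if "\<forall>(i, j)\<in>set c. 1 \<le> i"
    proof (cases c)
      case (Cons p c')
      obtain i j where p: "p = (i, j)" by (cases p)
      then show ?thesis
        unfolding Cons list.map prod.case concat.simps append.simps p
        using that[unfolded Cons p] by (subst sorted_wrt2[OF transp_on_less]) simp
    qed simp
    then show ?thesis
      unfolding cuts_def admissible_iff_sorted[OF order_refl] mem_Collect_eq by fastforce
  qed
  have full: "cut_to_tokens w 1 [(1, length w + 1)] = [Hole w]"
    by (simp add: subword_def)
  have full': "tokens_to_cut 1 [Hole w] = [(1, length w + 1)]" by simp
  have 1: "tokens_to_cut 1 (cut_to_tokens w 1 c) = c \<and> cut_to_tokens w 1 c \<in> cut_tokens L w" if "c \<in> cuts L w" for c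
  proof -
    have c: "admissible L w True 1 c" "c \<noteq> [(1, length w + 1)]" using that adm by auto
    note t = cut_to_tokens_props[OF c(1)]
    have "cut_to_tokens w 1 c \<noteq> [Hole w]" using t c(2) full' by (metis le_add2 order_refl)
    then show ?thesis using t by (simp add: cut_tokens_def)
  qed
  have 2: "cut_to_tokens w 1 (tokens_to_cut 1 x) = x \<and> tokens_to_cut 1 x \<in> cuts L w" if "x \<in> cut_tokens L w" for x
  proof -
    have x: "flat x = drop (1 - 1) w" "separated True x" "set (holes x) \<subseteq> L" "x \<noteq> [Hole w]"
      using that by (auto simp: cut_tokens_def)
    have p: "admissible L w True 1 (tokens_to_cut 1 x) \<and> cut_to_tokens w 1 (tokens_to_cut 1 x) = x"
      using tokens_to_cut_props[OF x(1-3) assms] by simp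
    then have "tokens_to_cut 1 x \<noteq> [(1, length w + 1)]" using x(4) full by metis
    then show ?thesis using p adm by blast
  qed
  show "\<forall>c\<in>cuts L w. tokens_to_cut 1 (cut_to_tokens w 1 c) = c" "cut_to_tokens w 1 ` cuts L w \<subseteq> cut_tokens L w" using 1 by auto
  show "\<forall>x\<in>cut_tokens L w. cut_to_tokens w 1 (tokens_to_cut 1 x) = x" "tokens_to_cut 1 ` cut_tokens L w \<subseteq> cuts L w"
    using 2 by auto
qed

section \<open>Nested cuts\<close>

fun erase :: "('a, ('a, 'a list) token list) token list \<Rightarrow> ('a, 'a list) token list" where
  "erase [] = []"
| "erase (Letter a # y) = Letter a # erase y"
| "erase (Hole x # y) = Hole (flat x) # erase y"

fun merge :: "('a, ('a, 'a list) token list) token list \<Rightarrow> ('a, 'a list) token list" where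
  "merge [] = []"
| "merge (Letter a # y) = Letter a # merge y"
| "merge (Hole x # y) = x @ merge y"

text \<open>A hole that the inner cut removes completely is no longer visible in the word left, so
  it has to disappear here; its right factor is the unit.\<close>

fun outer :: "('a, ('a, 'a list) token list) token list \<Rightarrow> ('a, 'a list) token list" where
  "outer [] = []"
| "outer (Letter a # y) = Letter a # outer y"
| "outer (Hole x # y) = (if kept x = [] then outer y else Hole (kept x) # outer y)"

text \<open>The right tensor factor belonging to a token list: \<open>[Hole w]\<close> gives the
  unit, as required for \<open>w \<otimes> 1\<close>, and a list that keeps a letter gives a
  one-word phrase.\<close>

definition kept_phrase :: "('a, 'h) token list \<Rightarrow> 'a list list" where
  "kept_phrase x = (if kept x = [] then [] else [kept x])"

lemma flat_merge: "flat (merge y) = flat (erase y)"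
  by (induction y rule: merge.induct) auto

text \<open>Together with \<open>holes_outer\<close> and \<open>kept_outer\<close> this shows that
  both readings of a nested cut produce the same three tensor factors.\<close>

lemma holes_merge: "holes (merge y) = concat (map holes (holes y))"
  by (induction y rule: merge.induct) auto

lemma flat_outer: "flat (outer y) = kept (merge y)"
  by (induction y rule: merge.induct) auto

lemma holes_outer: "holes (outer y) = concat (map kept_phrase (holes y))"
  by (induction y rule: merge.induct) (auto simp: kept_phrase_def)

lemma kept_outer: "kept (outer y) = kept y"
  by (induction y rule: merge.induct) auto

lemma kept_erase [simp]: "kept (erase y) = kept y"
  by (induction y rule: merge.induct) auto

lemma holes_erase [simp]: "holes (erase y) = map flat (holes y)"
  by (induction y rule: merge.induct) auto

lemma separated_erase [simp]: "separated b (erase y) = separated b y"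
  by (induction b y rule: separated.induct) auto

text \<open>A spliced cut may begin and end with a hole, but letters of \<open>y\<close> separate it
  from its neighbours, so no two holes meet.\<close>

lemma separated_merge: "separated b y \<Longrightarrow> \<forall>x\<in>set (holes y). separated True x \<Longrightarrow> separated b (merge y)"
  by (induction b y rule: separated.induct) (auto intro: separated_append)

lemma separated_outer: "separated b y \<Longrightarrow> separated b (outer y)"
  by (induction b y rule: separated.induct) (auto intro: separated_True)

text \<open>If one prefix is longer, the overhang keeps no letter, hence it would start with a hole;
  but it also starts \<open>m\<close> or \<open>m'\<close>, which may not begin with one.\<close>

lemma append_separated_eqD:
  assumes "x @ m = x' @ m'" "kept x = kept x'" "separated False m" "separated False m'"
  shows "x = x'"
proof -
  have *: "r = []" if "separated False (r @ n)" "kept r = []" for r n :: "('a, 'b) token list"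
    using that by (cases r rule: holes.cases) auto
  obtain r where "x = x' @ r \<and> r @ m = m' \<or> x @ r = x' \<and> m = r @ m'"
    using assms(1) by (auto simp: append_eq_append_conv2)
  then show ?thesis using *[of r m] *[of r m'] assms by auto
qed

text \<open>The nested list is read off from the left: \<open>outer\<close> tells which letters lie
  in a nested hole, and \<open>merge\<close> shows the holes that \<open>outer\<close> has lost. An
  empty nested hole would be invisible to both.\<close>

lemma merge_outer_inj:
  assumes "separated b y" "separated b' y'" "\<forall>x\<in>set (holes y) \<union> set (holes y'). separated True x \<and> x \<noteq> []"
    "merge y = merge y'" "outer y = outer y'"
  shows "y = y'"
  using assms
proof (induction y arbitrary: b b' y' rule: merge.induct)
  case 1
  then show ?case by (cases y' rule: merge.cases) auto
next
  case (2 a y)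
  \<comment> \<open>If \<open>y'\<close> began with a hole, then \<open>outer y'\<close> could begin
    with a letter only if that hole kept nothing; being non-empty, it would make
    \<open>merge y'\<close> begin with a hole.\<close>
  have "\<exists>y''. y' = Letter a # y''"
  proof (cases y' rule: merge.cases)
    case (3 x y'')
    then have "kept x = []" "x \<noteq> []" using 2 by (auto split: if_splits)
    then show ?thesis using 2 3 by (cases x rule: holes.cases) auto
  qed (use 2 in auto)
  then obtain y'' where "y' = Letter a # y''" by blast
  then show ?case using 2(1)[of True True y''] 2 by simp
next
  case (3 x y)
  have "\<exists>x' y''. y' = Hole x' # y''"
  proof (cases y' rule: merge.cases)
    case (2 a y'')
    then have "kept x = []" "x \<noteq> []" using 3 by (auto split: if_splits)
    then show ?thesis using 2 3 by (cases x rule: holes.cases) auto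
  qed (use 3 in auto)
  then obtain x' y'' where y': "y' = Hole x' # y''" by blast
  have so: "separated False (outer y)" "separated False (outer y'')"
    using 3 y' by (auto intro: separated_outer)
  have sm: "separated False (merge y)" "separated False (merge y'')"
    using 3 y' by (auto intro: separated_merge)
  \<comment> \<open>If just one of the two were empty, the tail of one \<open>outer\<close> would
    begin with a hole directly after a hole.\<close>
  have k: "kept x = kept x'"
  proof (cases "kept x = []")
    case True
    then show ?thesis using 3(6) y' so by (cases "kept x' = []") auto
  next
    case False
    then show ?thesis using 3(6) y' so by (cases "kept x' = []") (auto, metis separated.simps(3))
  qed
  have "x = x'" using append_separated_eqD[OF _ k sm] 3(5) y' by simp
  then show ?case using 3(1)[of False False y''] 3 y' k by (auto split: if_splits)
qed

text \<open>The holes at the boundary all go to \<open>x1\<close>, so that \<open>x2\<close> may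
  directly follow a nested hole.\<close>

lemma kept_split:
  assumes "kept x = u @ v"
  shows "\<exists>x1 x2. x = x1 @ x2 \<and> kept x1 = u \<and> kept x2 = v \<and> (\<forall>h x3. x2 \<noteq> Hole h # x3)"
  using assms
proof (induction x arbitrary: u rule: kept.induct)
  case (2 a x)
  show ?case
  proof (cases u)
    case Nil
    then show ?thesis using 2 by (intro exI[of _ "[]"] exI[of _ "Letter a # x"]) simp
  next
    case (Cons b u')
    then obtain x1 x2 where "x = x1 @ x2 \<and> kept x1 = u' \<and> kept x2 = v \<and> (\<forall>h x3. x2 \<noteq> Hole h # x3)"
      using 2 by fastforce
    then show ?thesis using 2 Cons by (intro exI[of _ "Letter a # x1"] exI[of _ x2]) simp
  qed
next
  case (3 h x)
  then obtain x1 x2 where "x = x1 @ x2 \<and> kept x1 = u \<and> kept x2 = v \<and> (\<forall>h x3. x2 \<noteq> Hole h # x3)"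
    by fastforce
  then show ?case by (intro exI[of _ "Hole h # x1"] exI[of _ x2]) simp
qed simp

text \<open>Holes of \<open>x\<close> at either end of a hole of \<open>z\<close> have to be absorbed into the nested hole, since
  two consecutive holes of \<open>y\<close> are forbidden.\<close>

lemma merge_outer_surj:
  assumes "separated b x" "separated b z" "flat z = kept x" "[] \<notin> set (holes z)"
  shows "\<exists>y. separated b y \<and> (\<forall>x\<in>set (holes y). separated True x \<and> x \<noteq> []) \<and> merge y = x \<and> outer y = z"
  using assms
proof (induction z arbitrary: b x rule: flat.induct)
  case 1
  then have "x = [] \<or> (\<exists>h. x = [Hole h])" using kept_Nil_separated separated_True by fastforce
  then show ?case
  proof
    assume "\<exists>h. x = [Hole h]"
    then obtain h where "x = [Hole h]" ..
    then show ?thesis using 1 by (intro exI[of _ "[Hole [Hole h]]"]) simp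
  qed (auto intro: exI[of _ "[]"])
next
  case (2 a z)
  show ?case
  proof (cases x rule: holes.cases)
    case (2 a' x')
    then obtain y where "separated True y \<and> (\<forall>x\<in>set (holes y). separated True x \<and> x \<noteq> []) \<and> merge y = x' \<and> outer y = z"
      using "2.IH"[of True x'] "2.prems" by auto
    then show ?thesis using 2 "2.prems" by (intro exI[of _ "Letter a # y"]) simp
  next
    \<comment> \<open>This hole lies before a letter outside all holes of \<open>z\<close>. It must
      be an outer hole cut as a whole, \<open>Hole [Hole h]\<close>, which \<open>outer\<close>
      deletes; by separation the letter \<open>a\<close> comes next.\<close>
    case (3 h x')
    then obtain x'' where x': "x' = Letter a # x''"
      using "2.prems" by (cases x' rule: holes.cases) auto
    then obtain y where "separated True y \<and> (\<forall>x\<in>set (holes y). separated True x \<and> x \<noteq> []) \<and> merge y = x'' \<and> outer y = z"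
      using "2.IH"[of True x''] "2.prems" 3 by auto
    then show ?thesis using 3 x' "2.prems" by (intro exI[of _ "Hole [Hole h] # Letter a # y"]) simp
  qed (use "2.prems" in simp)
next
  case (3 u z)
  obtain x1 x2 where x: "x = x1 @ x2" "kept x1 = u" "kept x2 = flat z" "\<forall>h x3. x2 \<noteq> Hole h # x3"
    using kept_split[of x u "flat z"] 3 by auto
  have b: b using 3 by simp
  have s: "separated True x1" "separated False x2"
    using separated_appendD[of b x1 x2] 3(2) x b by (auto, cases x2 rule: holes.cases, auto)
  have "u \<noteq> []" "x1 \<noteq> []" using 3 x by auto
  moreover obtain y where "separated False y \<and> (\<forall>x\<in>set (holes y). separated True x \<and> x \<noteq> []) \<and> merge y = x2 \<and> outer y = z"
  proof -
    have "\<exists>y. separated False y \<and> (\<forall>x\<in>set (holes y). separated True x \<and> x \<noteq> []) \<and> merge y = x2 \<and> outer y = z"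
      by (rule 3(1)) (use 3(3,5) s x in auto)
    then show ?thesis using that by blast
  qed
  ultimately show ?case using b s x by (intro exI[of _ "Hole x1 # y"]) simp
qed

section \<open>Stability in terms of token lists\<close>

lemma stable_subset: "stable A L \<Longrightarrow> L \<subseteq> nonempty_words A"
  unfolding stable_def by (rule conjunct1)

lemma stable_Nil: "stable A L \<Longrightarrow> [] \<notin> L"
  using stable_subset subsetD nonempty_words_iff by metis

text \<open>Stability without positions: \<open>u @ v \<noteq> []\<close> replaces the exclusion of
  \<open>(1, m + 1)\<close>.\<close>

lemma stable_insert:
  assumes "stable A L" "h \<in> L" "u @ v \<noteq> []" "set (u @ h @ v) \<subseteq> A"
  shows "u @ h @ v \<in> L \<longleftrightarrow> u @ v \<in> L"
proof -
  let ?w = "u @ h @ v" and ?i = "length u + 1" and ?j = "length u + length h + 1"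
  have h: "h \<noteq> []" using assms(2) stable_Nil[OF assms(1)] by auto
  have sub: "subword ?w ?i ?j = h" "subword ?w 1 ?i = u" "subword ?w ?j (length ?w + 1) = v"
    by (simp_all add: subword_def)
  have "?w \<in> nonempty_words A" using h assms(4) by (simp add: nonempty_words_iff)
  moreover have "1 \<le> ?i \<and> ?i < ?j \<and> ?j \<le> length ?w + 1 \<and> (?i, ?j) \<noteq> (1, length ?w + 1) \<and> subword ?w ?i ?j \<in> L"
    using h assms(2,3) sub(1) by auto
  ultimately have "?w \<in> L \<longleftrightarrow> subword ?w 1 ?i @ subword ?w ?j (length ?w + 1) \<in> L"
    using assms(1) unfolding stable_def by blast
  then show ?thesis unfolding sub .
qed

text \<open>The holes are removed one at a time from the left. The generalized prefix
  \<open>p\<close> collects the letters already passed, so that the next hole sits inside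
  \<open>p @ h @ flat x\<close>.\<close>

lemma stable_kept:
  assumes "stable A L" "set (holes x) \<subseteq> L" "kept x \<noteq> []" "set (flat x) \<subseteq> A"
  shows "flat x \<in> L \<longleftrightarrow> kept x \<in> L"
proof -
  have "p @ flat x \<in> L \<longleftrightarrow> p @ kept x \<in> L"
    if "set (holes x) \<subseteq> L" "p @ kept x \<noteq> []" "set (p @ flat x) \<subseteq> A" for p
    using that
  proof (induction x arbitrary: p rule: flat.induct)
    case (2 a x)
    then show ?case using 2(1)[of "p @ [a]"] by simp
  next
    case (3 h x)
    \<comment> \<open>Needed before each removal: a letter that survives all removals also survives
      this one.\<close>
    have "p @ flat x \<noteq> []" using 3(3) kept_subset_flat[of x] by auto
    then have "p @ h @ flat x \<in> L \<longleftrightarrow> p @ flat x \<in> L"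
      using stable_insert[OF assms(1), of h p "flat x"] 3 by simp
    then show ?case using 3 by simp
  qed simp
  from this[of "[]"] show ?thesis using assms by simp
qed

text \<open>A nested cut is a proper cut of \<open>w\<close> each of whose holes is itself cut, possibly as a whole. It is
  determined by the outer cut with the cuts of its holes (\<open>erase\<close>, \<open>holes\<close>), and also by the
  inner cut \<open>merge\<close> of \<open>w\<close> with the cut \<open>outer\<close> of what that inner cut leaves.\<close>

definition nested_cuts :: "'a list set \<Rightarrow> 'a list \<Rightarrow> ('a, ('a, 'a list) token list) token list set" where
  "nested_cuts L w = {y. separated True y \<and>
     (\<forall>x\<in>set (holes y). separated True x \<and> set (holes x) \<subseteq> L \<and> flat x \<in> L) \<and>
     flat (erase y) = w \<and> (\<forall>x. y \<noteq> [Hole x])}"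

text \<open>Matches the one exclusion for nested cuts with the two exclusions for successive cuts. A
  lone nested hole shows up in \<open>merge\<close> if it keeps nothing and in \<open>outer\<close>
  otherwise; conversely, both alternatives force \<open>kept y = []\<close>.\<close>

lemma singleton_Hole_iff:
  assumes "separated True y" "\<forall>x\<in>set (holes y). separated True x \<and> x \<noteq> []"
  shows "(\<exists>x. y = [Hole x]) \<longleftrightarrow> (\<exists>h. merge y = [Hole h]) \<or> (\<exists>h. outer y = [Hole h])"
proof
  assume "\<exists>x. y = [Hole x]"
  then obtain x where y: "y = [Hole x]" ..
  then show "(\<exists>h. merge y = [Hole h]) \<or> (\<exists>h. outer y = [Hole h])"
    using assms kept_Nil_separated[of x] by auto
next
  assume "(\<exists>h. merge y = [Hole h]) \<or> (\<exists>h. outer y = [Hole h])"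
  then have "kept y = [] \<and> y \<noteq> []"
  proof
    assume "\<exists>h. merge y = [Hole h]"
    then show ?thesis
      using kept_subset_flat[of "outer y"] by (auto simp: flat_outer kept_outer)
  next
    assume "\<exists>h. outer y = [Hole h]"
    then show ?thesis using kept_outer[of y] by auto
  qed
  then show "\<exists>x. y = [Hole x]" using kept_Nil_separated[OF assms(1)] by auto
qed

text \<open>Stability is used in both directions: from the hole to the word left of it when a nested
  cut is split, and back when two successive cuts are nested.\<close>

lemma bij_betw_merge_outer:
  assumes st: "stable A L" and w: "set w \<subseteq> A"
  shows "bij_betw (\<lambda>y. (merge y, outer y)) (nested_cuts L w)
    (Sigma (cut_tokens L w) (\<lambda>x. cut_tokens L (kept x)))"
proof (rule bij_betw_imageI)
  have L: "[] \<notin> L" using stable_Nil[OF st] .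
  have ne: "x \<noteq> []" if "flat x \<in> L" for x using that L by (cases x) auto
  have N: "\<forall>x\<in>set (holes y). separated True x \<and> x \<noteq> []" if "y \<in> nested_cuts L w" for y
    using that ne unfolding nested_cuts_def by simp
  show "inj_on (\<lambda>y. (merge y, outer y)) (nested_cuts L w)"
  proof (rule inj_onI)
    fix y y' assume y: "y \<in> nested_cuts L w" "y' \<in> nested_cuts L w" "(merge y, outer y) = (merge y', outer y')"
    then have "separated True y" "separated True y'" by (simp_all add: nested_cuts_def)
    moreover have "\<forall>x\<in>set (holes y) \<union> set (holes y'). separated True x \<and> x \<noteq> []"
      using N[OF y(1)] N[OF y(2)] by blast
    ultimately show "y = y'" by (rule merge_outer_inj) (use y(3) in simp_all)
  qed
  show "(\<lambda>y. (merge y, outer y)) ` nested_cuts L w = Sigma (cut_tokens L w) (\<lambda>x. cut_tokens L (kept x))"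
  proof (intro equalityI subsetI)
    fix p assume "p \<in> (\<lambda>y. (merge y, outer y)) ` nested_cuts L w"
    then obtain y where p: "p = (merge y, outer y)" and y: "y \<in> nested_cuts L w" by auto
    have "flat x \<in> L" "set (holes x) \<subseteq> L" "set (flat x) \<subseteq> A" if "x \<in> set (holes y)" for x
    proof -
      show "flat x \<in> L" "set (holes x) \<subseteq> L" using y that by (auto simp: nested_cuts_def)
      then have "flat x \<in> nonempty_words A" using stable_subset[OF st] by blast
      then show "set (flat x) \<subseteq> A" by (simp add: nonempty_words_iff)
    qed
    then have "kept x \<in> L" if "x \<in> set (holes y)" "kept x \<noteq> []" for x
      using stable_kept[OF st, of x] that by blast
    then have "set (holes (outer y)) \<subseteq> L" by (auto simp: holes_outer kept_phrase_def)
    moreover have "set (holes (merge y)) \<subseteq> L" using y by (auto simp: holes_merge nested_cuts_def)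
    moreover have "separated True (merge y)" "separated True (outer y)" "flat (merge y) = w"
      using y by (auto simp: nested_cuts_def flat_merge intro: separated_merge separated_outer)
    moreover have "(\<nexists>h. merge y = [Hole h]) \<and> (\<nexists>h. outer y = [Hole h])"
      using singleton_Hole_iff[of y] N[OF y] y by (auto simp: nested_cuts_def)
    ultimately show "p \<in> Sigma (cut_tokens L w) (\<lambda>x. cut_tokens L (kept x))"
      by (auto simp: p cut_tokens_def flat_outer)
  next
    fix p assume "p \<in> Sigma (cut_tokens L w) (\<lambda>x. cut_tokens L (kept x))"
    then obtain x z where p: "p = (x, z)" and x: "x \<in> cut_tokens L w" and z: "z \<in> cut_tokens L (kept x)" by auto
    obtain y where y: "separated True y" "\<forall>x\<in>set (holes y). separated True x \<and> x \<noteq> []" "merge y = x" "outer y = z"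
      using merge_outer_surj[of True x z] x z L by (auto simp: cut_tokens_def)
    have fl: "flat (erase y) = w" using x y flat_merge[of y] by (simp add: cut_tokens_def)
    have hs: "set (holes v) \<subseteq> L" if "v \<in> set (holes y)" for v
      using x y that holes_merge[of y] by (auto simp: cut_tokens_def)
    have fv: "flat v \<in> L" if v: "v \<in> set (holes y)" for v
    proof (cases "kept v = []")
      case True
      \<comment> \<open>Nothing is left of this hole, so it coincides with a hole of
        \<open>x\<close> and lies in \<open>L\<close> for that reason.\<close>
      then obtain h where "v = [Hole h]" using kept_Nil_separated[of v] v y by auto
      then show ?thesis using hs[OF v] by auto
    next
      case False
      then have "kept v \<in> set (holes z)" using holes_outer[of y] y v by (auto simp: kept_phrase_def)
      then have "kept v \<in> L" using z by (auto simp: cut_tokens_def)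
      moreover have "set (flat v) \<subseteq> A"
      proof -
        have "set (concat (holes (erase y))) \<subseteq> set (flat (erase y))" for y :: "('a, ('a, 'a list) token list) token list"
          by (induction y rule: erase.induct) auto
        from this[of y] have "set (flat v) \<subseteq> set (flat (erase y))" using v by auto
        then show ?thesis using fl w by simp
      qed
      ultimately show ?thesis using stable_kept[OF st hs[OF v] False] by blast
    qed
    have "\<nexists>v. y = [Hole v]"
    proof -
      have "x \<noteq> [Hole h]" "z \<noteq> [Hole h]" for h using x z by (auto simp: cut_tokens_def)
      then show ?thesis unfolding singleton_Hole_iff[OF y(1,2)] y(3,4) by blast
    qed
    moreover have "\<forall>v\<in>set (holes y). separated True v \<and> set (holes v) \<subseteq> L \<and> flat v \<in> L"
      using y(2) hs fv by simp
    ultimately have "y \<in> nested_cuts L w" using y(1) fl unfolding nested_cuts_def by simp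
    then show "p \<in> (\<lambda>y. (merge y, outer y)) ` nested_cuts L w"
      by (rule rev_image_eqI) (simp add: p y)
  qed
qed

text \<open>The list \<open>[Hole w]\<close> stands for the summand \<open>w \<otimes> 1\<close> of the coproduct of \<open>w\<close>; it is
  added even if \<open>w\<close> is not in \<open>L\<close>.\<close>

definition word_tokens :: "'a list set \<Rightarrow> 'a list \<Rightarrow> ('a, 'a list) token list set" where
  "word_tokens L w = insert [Hole w] (cut_tokens L w)"

text \<open>\<open>listset\<close> collects the choices of one list from \<open>word_tokens\<close>
  for each hole; filling these into the holes of the outer cut recovers the nested cut.\<close>

lemma bij_betw_erase_holes:
  assumes "[] \<notin> L"
  shows "bij_betw (\<lambda>y. (erase y, holes y)) (nested_cuts L w)
    (Sigma (cut_tokens L w) (\<lambda>x. listset (map (word_tokens L) (holes x))))"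
proof (rule bij_betw_imageI)
  have eq: "y = y'" if "erase y = erase y'" "holes y = holes y'" for y y' :: "('a, ('a, 'a list) token list) token list"
    using that
  proof (induction y arbitrary: y' rule: erase.induct)
    case 1 then show ?case by (cases y' rule: erase.cases) auto
  next
    case 2 then show ?case by (cases y' rule: erase.cases) auto
  next
    case 3 then show ?case by (cases y' rule: erase.cases) auto
  qed
  then show "inj_on (\<lambda>y. (erase y, holes y)) (nested_cuts L w)" by (auto intro: inj_onI)
  \<comment> \<open>For \<open>h\<close> in \<open>L\<close> the added list \<open>[Hole h]\<close>
    has its hole in \<open>L\<close>, so it exactly undoes the exclusion in
    \<open>cut_tokens\<close> and no exception remains.\<close>
  have WT: "x \<in> word_tokens L h \<longleftrightarrow> separated True x \<and> set (holes x) \<subseteq> L \<and> flat x = h" if "h \<in> L" for x h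
    using that by (auto simp: word_tokens_def cut_tokens_def)
  have LS: "xs \<in> listset (map (word_tokens L) hs) \<longleftrightarrow>
      (\<forall>x\<in>set xs. separated True x \<and> set (holes x) \<subseteq> L) \<and> map flat xs = hs" if "set hs \<subseteq> L" for xs hs
    using that
  proof (induction hs arbitrary: xs)
    case (Cons h hs)
    then show ?case by (cases xs) (auto simp: set_Cons_def WT)
  qed auto
  have ex: "\<exists>y. erase y = x \<and> holes y = xs" if "holes x = map flat xs" for x :: "('a, 'a list) token list" and xs
    using that
  proof (induction x arbitrary: xs rule: holes.induct)
    case 1
    then show ?case by (auto intro: exI[of _ "[]"])
  next
    case (2 a x)
    then obtain y where "erase y = x \<and> holes y = xs" by fastforce
    then show ?case by (intro exI[of _ "Letter a # y"]) simp
  next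
    case (3 h x)
    then obtain v vs where xs: "xs = v # vs" "h = flat v" by (cases xs) auto
    then obtain y where "erase y = x \<and> holes y = vs" using 3 by fastforce
    then show ?case using xs by (intro exI[of _ "Hole v # y"]) simp
  qed
  have er: "(\<exists>v. y = [Hole v]) \<longleftrightarrow> (\<exists>h. erase y = [Hole h])" for y :: "('a, ('a, 'a list) token list) token list"
  proof (cases y rule: erase.cases)
    case (3 x z)
    then show ?thesis by (cases z rule: erase.cases) auto
  qed auto
  have er': "flat (erase y) = w \<Longrightarrow> (erase y \<noteq> [Hole w]) = (\<forall>v. y \<noteq> [Hole v])" for y
    using er[of y] by auto
  show "(\<lambda>y. (erase y, holes y)) ` nested_cuts L w =
      Sigma (cut_tokens L w) (\<lambda>x. listset (map (word_tokens L) (holes x)))"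
  proof (intro equalityI subsetI)
    fix p assume "p \<in> (\<lambda>y. (erase y, holes y)) ` nested_cuts L w"
    then obtain y where p: "p = (erase y, holes y)" and y: "y \<in> nested_cuts L w" by auto
    have "erase y \<in> cut_tokens L w" using y er'[of y] by (auto simp: nested_cuts_def cut_tokens_def)
    moreover have "holes y \<in> listset (map (word_tokens L) (holes (erase y)))"
      using y by (subst LS) (auto simp: nested_cuts_def)
    ultimately show "p \<in> Sigma (cut_tokens L w) (\<lambda>x. listset (map (word_tokens L) (holes x)))"
      unfolding p by blast
  next
    fix p assume "p \<in> Sigma (cut_tokens L w) (\<lambda>x. listset (map (word_tokens L) (holes x)))"
    then obtain x xs where p: "p = (x, xs)" and x: "x \<in> cut_tokens L w"
      and xs: "xs \<in> listset (map (word_tokens L) (holes x))" by auto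
    have hx: "set (holes x) \<subseteq> L" using x by (simp add: cut_tokens_def)
    note xs' = xs[unfolded LS[OF hx]]
    then obtain y where y: "erase y = x" "holes y = xs" using ex by metis
    have "y \<in> nested_cuts L w"
    proof -
      have "flat (erase y) = w" "separated True (erase y)" "erase y \<noteq> [Hole w]"
        using x by (auto simp: y cut_tokens_def)
      moreover have "\<forall>v\<in>set (holes y). separated True v \<and> set (holes v) \<subseteq> L \<and> flat v \<in> L"
      proof
        fix v assume v: "v \<in> set (holes y)"
        then have "flat v \<in> set (map flat xs)" by (simp add: y)
        then have "flat v \<in> L" using xs' hx by auto
        then show "separated True v \<and> set (holes v) \<subseteq> L \<and> flat v \<in> L" using v xs' by (simp add: y)
      qed
      ultimately show ?thesis using er'[of y] by (simp add: nested_cuts_def)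
    qed
    then show "p \<in> (\<lambda>y. (erase y, holes y)) ` nested_cuts L w"
      by (rule rev_image_eqI) (simp add: p y)
  qed
qed

text \<open>The combinatorial core of coassociativity. The inner sum on the left has the shape of
  the expanded product of the coproducts of all words of \<open>l_c(w)\<close>.\<close>

lemma sum_nested_cuts:
  fixes g :: "'a list list \<Rightarrow> 'a list list \<Rightarrow> 'a list list \<Rightarrow> 'b::comm_monoid_add"
  assumes st: "stable A L" and w: "set w \<subseteq> A"
  shows "(\<Sum>x\<in>cut_tokens L w. \<Sum>xs\<in>listset (map (word_tokens L) (holes x)).
      g (concat (map holes xs)) (concat (map kept_phrase xs)) (kept_phrase x)) =
    (\<Sum>x\<in>cut_tokens L w. \<Sum>z\<in>cut_tokens L (kept x). g (holes x) (holes z) (kept_phrase z))"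
proof -
  have L: "[] \<notin> L" using stable_Nil[OF st] .
  have fin: "finite (cut_tokens L w)" for w
    using bij_betw_finite[OF bij_betw_cut_to_tokens[OF L, of w]] finite_cuts by blast
  have fin2: "finite (listset (map (word_tokens L) hs))" for hs
  proof (induction hs)
    case (Cons h hs)
    have "set_Cons X Y = (\<lambda>(x, xs). x # xs) ` (X \<times> Y)" for X :: "'x set" and Y
      by (auto simp: set_Cons_def)
    from this[of "word_tokens L h"] show ?case using Cons by (simp add: word_tokens_def fin)
  qed simp
  have "(\<Sum>x\<in>cut_tokens L w. \<Sum>xs\<in>listset (map (word_tokens L) (holes x)).
      g (concat (map holes xs)) (concat (map kept_phrase xs)) (kept_phrase x)) =
    (\<Sum>(x, xs)\<in>Sigma (cut_tokens L w) (\<lambda>x. listset (map (word_tokens L) (holes x))).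
      g (concat (map holes xs)) (concat (map kept_phrase xs)) (kept_phrase x))"
    by (rule sum.Sigma) (auto simp: fin fin2)
  also have "\<dots> = (\<Sum>y\<in>nested_cuts L w. g (holes (merge y)) (holes (outer y)) (kept_phrase (outer y)))"
    by (subst sum.reindex_bij_betw[OF bij_betw_erase_holes[OF L], symmetric])
       (simp add: holes_merge holes_outer kept_phrase_def kept_outer cong: if_cong)
  also have "\<dots> = (\<Sum>(x, z)\<in>Sigma (cut_tokens L w) (\<lambda>x. cut_tokens L (kept x)). g (holes x) (holes z) (kept_phrase z))"
    by (subst sum.reindex_bij_betw[OF bij_betw_merge_outer[OF st w], symmetric]) simp
  also have "\<dots> = (\<Sum>x\<in>cut_tokens L w. \<Sum>z\<in>cut_tokens L (kept x). g (holes x) (holes z) (kept_phrase z))"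
    by (rule sum.Sigma[symmetric]) (auto simp: fin)
  finally show ?thesis .
qed

section \<open>Linear extension\<close>

abbreviation basis_vec :: "'b \<Rightarrow> ('b \<Rightarrow>\<^sub>0 'r::{comm_ring,comm_monoid_mult})" where
  "basis_vec x \<equiv> Poly_Mapping.single x 1"

lemma smult_add_right: "smult c (p + q) = smult c p + smult c q"
  by (rule poly_mapping_eqI) (simp add: lookup_add distrib_left)

lemma smult_add_left: "smult (c + d) p = smult c p + smult d p"
  by (rule poly_mapping_eqI) (simp add: lookup_add distrib_right)

lemma smult_smult: "smult c (smult d p) = smult (c * d) p"
  by (rule poly_mapping_eqI) (simp add: mult.assoc)

lemma smult_one [simp]: "smult 1 p = p"
  by (rule poly_mapping_eqI) simp

lemma smult_zero_left [simp]: "smult 0 p = 0"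
  by (rule poly_mapping_eqI) simp

lemma smult_zero_right [simp]: "smult c 0 = 0"
  by (rule poly_mapping_eqI) simp

lemma smult_diff: "smult c (p - q) = smult c p - smult c q"
  by (rule poly_mapping_eqI) (simp add: lookup_minus right_diff_distrib)

lemma smult_sum: "smult c (sum f X) = (\<Sum>x\<in>X. smult c (f x))"
  by (induction X rule: infinite_finite_induct) (auto simp: smult_add_right)

lemma smult_single: "smult c (Poly_Mapping.single x d) = Poly_Mapping.single x (c * d)"
  by (rule poly_mapping_eqI) (simp add: lookup_single when_def)

lemma lin_ext_superset:
  assumes "finite Z" "Poly_Mapping.keys p \<subseteq> Z"
  shows "lin_ext f p = (\<Sum>x\<in>Z. smult (Poly_Mapping.lookup p x) (f x))"
  unfolding lin_ext_def using assms by (intro sum.mono_neutral_left) (auto simp: in_keys_iff)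

lemma lin_ext_zero [simp]: "lin_ext f 0 = 0"
  by (simp add: lin_ext_def)

lemma lin_ext_basis_vec [simp]: "lin_ext f (basis_vec x) = f x"
  by (subst lin_ext_superset[of "{x}"]) auto

lemma lin_ext_add: "lin_ext f (p + q) = lin_ext f p + lin_ext f q"
proof -
  let ?Z = "Poly_Mapping.keys p \<union> Poly_Mapping.keys q"
  have "lin_ext f (p + q) = (\<Sum>x\<in>?Z. smult (Poly_Mapping.lookup (p + q) x) (f x))"
    by (intro lin_ext_superset keys_add) auto
  then show ?thesis
    by (simp add: lookup_add smult_add_left sum.distrib lin_ext_superset[of ?Z p] lin_ext_superset[of ?Z q])
qed

lemma lin_ext_smult: "lin_ext f (smult c p) = smult c (lin_ext f p)"
proof -
  have "lin_ext f (smult c p) = (\<Sum>x\<in>Poly_Mapping.keys p. smult (Poly_Mapping.lookup (smult c p) x) (f x))"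
    by (intro lin_ext_superset) (auto simp: in_keys_iff)
  then show ?thesis by (simp add: lin_ext_def smult_sum smult_smult)
qed

lemma lin_ext_sum: "lin_ext f (sum g X) = (\<Sum>x\<in>X. lin_ext f (g x))"
  by (induction X rule: infinite_finite_induct) (auto simp: lin_ext_add)

lemma lin_ext_lin_ext: "lin_ext f (lin_ext g p) = lin_ext (\<lambda>x. lin_ext f (g x)) p"
  by (simp add: lin_ext_def[of g] lin_ext_def[of "\<lambda>x. lin_ext f (g x)"] lin_ext_sum lin_ext_smult)

lemma lin_ext_cong: "(\<And>x. x \<in> Poly_Mapping.keys p \<Longrightarrow> f x = g x) \<Longrightarrow> lin_ext f p = lin_ext g p"
  by (simp add: lin_ext_def)

lemma lin_ext_cong_free_mod: "p \<in> free_mod B \<Longrightarrow> (\<And>x. x \<in> B \<Longrightarrow> f x = g x) \<Longrightarrow> lin_ext f p = lin_ext g p"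
  by (rule lin_ext_cong) (auto simp: free_mod_def)

lemma lin_ext_fun_add: "lin_ext (\<lambda>x. f x + g x) p = lin_ext f p + lin_ext g p"
  by (simp add: lin_ext_def smult_add_right sum.distrib)

lemma lin_ext_fun_diff: "lin_ext (\<lambda>x. f x - g x) p = lin_ext f p - lin_ext g p"
  by (simp add: lin_ext_def smult_diff sum_subtractf)

lemma lin_ext_fun_smult: "lin_ext (\<lambda>x. smult c (f x)) p = smult c (lin_ext f p)"
  by (simp add: lin_ext_def smult_sum smult_smult mult.commute)

lemma lin_ext_fun_zero [simp]: "lin_ext (\<lambda>x. 0) p = 0"
  by (simp add: lin_ext_def)

lemma lin_ext_swap: "lin_ext (\<lambda>x. lin_ext (f x) q) p = lin_ext (\<lambda>y. lin_ext (\<lambda>x. f x y) p) q"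
  unfolding lin_ext_def smult_sum smult_smult
  by (subst sum.swap) (simp add: mult.commute)

lemma lin_ext_id [simp]: "lin_ext basis_vec p = p"
  unfolding lin_ext_def by (rule basis_expansion[symmetric])

lemma free_mod_zero [simp]: "0 \<in> free_mod B"
  by (simp add: free_mod_def)

lemma free_mod_basis_vec: "x \<in> B \<Longrightarrow> basis_vec x \<in> free_mod B"
  by (simp add: free_mod_def)

lemma free_mod_add: "p \<in> free_mod B \<Longrightarrow> q \<in> free_mod B \<Longrightarrow> p + q \<in> free_mod B"
  unfolding free_mod_def using keys_add[of p q] by blast

lemma free_mod_smult: "p \<in> free_mod B \<Longrightarrow> smult c p \<in> free_mod B"
  unfolding free_mod_def mem_Collect_eq subset_iff in_keys_iff lookup_smult by (metis mult_zero_right)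

lemma free_mod_sum: "(\<And>x. x \<in> X \<Longrightarrow> f x \<in> free_mod B) \<Longrightarrow> sum f X \<in> free_mod B"
  by (induction X rule: infinite_finite_induct) (auto intro: free_mod_add)

lemma free_mod_lin_ext: "p \<in> free_mod B \<Longrightarrow> (\<And>x. x \<in> B \<Longrightarrow> f x \<in> free_mod C) \<Longrightarrow> lin_ext f p \<in> free_mod C"
  unfolding lin_ext_def by (rule free_mod_sum) (auto intro!: free_mod_smult simp: free_mod_def[of B])

lemma submodule_free_mod: "B \<subseteq> C \<Longrightarrow> submodule C (free_mod B)"
  unfolding submodule_def by (auto intro: free_mod_add free_mod_smult) (auto simp: free_mod_def)

lemma linear_map_lin_ext: "(\<And>x. x \<in> B \<Longrightarrow> f x \<in> free_mod C) \<Longrightarrow> linear_map B C (lin_ext f)"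
  unfolding linear_map_def by (auto intro: free_mod_lin_ext simp: lin_ext_add lin_ext_smult)

lemma linear_map_zero: "linear_map B C f \<Longrightarrow> f 0 = 0"
proof -
  assume "linear_map B C f"
  then have "f (0 + 0) = f 0 + f 0" unfolding linear_map_def by (meson free_mod_zero)
  then show ?thesis by simp
qed

lemma linear_map_eqI:
  assumes f: "linear_map B C f" and g: "linear_map B C g"
    and eq: "\<And>x. x \<in> B \<Longrightarrow> f (basis_vec x) = g (basis_vec x)" and "p \<in> free_mod B"
  shows "f p = g p"
  using assms(4)
proof (induction rule: free_mod_sum_induct)
  case zero
  then show ?case by (simp add: linear_map_zero[OF f] linear_map_zero[OF g])
next
  case (add c x p)
  have lin: "h (smult c (basis_vec x) + p) = smult c (h (basis_vec x)) + h p" if "linear_map B C h" for h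
    using that add(1,2) unfolding linear_map_def by (metis free_mod_basis_vec free_mod_smult)
  show ?case unfolding lin[OF f] lin[OF g] eq[OF add(1)] add(3) ..
qed

section \<open>Bilinear extension\<close>

text \<open>The tensor product of vectors and the multiplications on phrases and on pairs of phrases
  are all of this form, so bilinearity, associativity and multiplicativity are proved once.\<close>

definition bilin_ext :: "('b \<Rightarrow> 'c \<Rightarrow> 'd) \<Rightarrow> ('b \<Rightarrow>\<^sub>0 'r) \<Rightarrow> ('c \<Rightarrow>\<^sub>0 'r) \<Rightarrow> ('d \<Rightarrow>\<^sub>0 'r::{comm_ring,comm_monoid_mult})" where
  "bilin_ext m u v = lin_ext (\<lambda>a. lin_ext (\<lambda>b. basis_vec (m a b)) v) u"

lemma bilin_ext_basis_vec [simp]: "bilin_ext m (basis_vec a) (basis_vec b) = basis_vec (m a b)"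
  by (simp add: bilin_ext_def)

lemma bilin_ext_zero [simp]: "bilin_ext m 0 v = 0" "bilin_ext m u 0 = 0"
  by (simp_all add: bilin_ext_def)

lemma bilin_ext_add_left: "bilin_ext m (u + u') v = bilin_ext m u v + bilin_ext m u' v"
  by (simp add: bilin_ext_def lin_ext_add)

lemma bilin_ext_add_right: "bilin_ext m u (v + v') = bilin_ext m u v + bilin_ext m u v'"
  by (simp add: bilin_ext_def lin_ext_add lin_ext_fun_add)

lemma bilin_ext_smult_left: "bilin_ext m (smult c u) v = smult c (bilin_ext m u v)"
  by (simp add: bilin_ext_def lin_ext_smult)

lemma bilin_ext_smult_right: "bilin_ext m u (smult c v) = smult c (bilin_ext m u v)"
  by (simp add: bilin_ext_def lin_ext_smult lin_ext_fun_smult)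

lemma bilin_ext_sum_left: "bilin_ext m (sum f X) v = (\<Sum>x\<in>X. bilin_ext m (f x) v)"
  by (simp add: bilin_ext_def lin_ext_sum)

lemma bilin_ext_sum_right: "bilin_ext m u (sum f X) = (\<Sum>x\<in>X. bilin_ext m u (f x))"
  by (induction X rule: infinite_finite_induct) (auto simp: bilin_ext_add_right)

lemma bilin_ext_lin_ext_left: "bilin_ext m (lin_ext f p) v = lin_ext (\<lambda>x. bilin_ext m (f x) v) p"
  by (simp add: bilin_ext_def lin_ext_lin_ext)

lemma bilin_ext_lin_ext_right: "bilin_ext m u (lin_ext f p) = lin_ext (\<lambda>x. bilin_ext m u (f x)) p"
  unfolding bilin_ext_def lin_ext_lin_ext by (rule lin_ext_swap)

lemma free_mod_bilin_ext:
  assumes "u \<in> free_mod B" "v \<in> free_mod C" "\<And>a b. a \<in> B \<Longrightarrow> b \<in> C \<Longrightarrow> m a b \<in> E"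
  shows "bilin_ext m u v \<in> free_mod E"
  unfolding bilin_ext_def using assms by (intro free_mod_lin_ext free_mod_basis_vec) auto

text \<open>With \<open>h = h1 = h2\<close>: a map that is multiplicative on the basis extends to a multiplicative map.\<close>

lemma lin_ext_bilin_ext:
  assumes "\<And>a b. h (m a b) = bilin_ext m' (h1 a) (h2 b)"
  shows "lin_ext h (bilin_ext m u v) = bilin_ext m' (lin_ext h1 u) (lin_ext h2 v)"
proof -
  have "lin_ext h (bilin_ext m u v) = lin_ext (\<lambda>a. lin_ext (\<lambda>b. bilin_ext m' (h1 a) (h2 b)) v) u"
    by (simp add: bilin_ext_def[of m] lin_ext_lin_ext assms)
  then show ?thesis unfolding bilin_ext_lin_ext_left bilin_ext_lin_ext_right[of _ "h1 _"] .
qed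

lemma bilin_ext_assoc:
  assumes "\<And>a b c. m (m a b) c = m a (m b c)"
  shows "bilin_ext m (bilin_ext m u v) w = bilin_ext m u (bilin_ext m v w)"
  by (simp add: bilin_ext_def lin_ext_lin_ext assms)

lemma tens_eq_bilin_ext: "tens p q = bilin_ext Pair p q"
  by (simp add: tens_def bilin_ext_def lin_ext_def smult_sum smult_smult smult_single)

lemma phrase_mult_eq_bilin_ext: "phrase_mult p q = bilin_ext (@) p q"
  by (simp add: phrase_mult_def bilin_ext_def lin_ext_def smult_sum smult_smult smult_single)

text \<open>The product of \<open>\<P> \<otimes> \<P>\<close> on basis vectors;
  \<open>append3\<close> is its analogue for three factors, needed because coassociativity is an
  equation between multiplicative maps.\<close>

fun append2 :: "'a list \<times> 'b list \<Rightarrow> 'a list \<times> 'b list \<Rightarrow> 'a list \<times> 'b list" where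
  "append2 (a, b) (a', b') = (a @ a', b @ b')"

fun append3 :: "'a list \<times> 'b list \<times> 'c list \<Rightarrow> 'a list \<times> 'b list \<times> 'c list \<Rightarrow> 'a list \<times> 'b list \<times> 'c list" where
  "append3 (a, b, c) (a', b', c') = (a @ a', b @ b', c @ c')"

lemma append2_assoc: "append2 (append2 p q) r = append2 p (append2 q r)"
  by (cases p; cases q; cases r) simp

lemma tensor_mult_eq_bilin_ext: "tensor_mult phrase_mult u v = bilin_ext append2 u v"
  unfolding tensor_mult_def bilin_ext_def lin_ext_def smult_sum smult_smult
  by (auto intro!: sum.cong simp: phrase_mult_eq_bilin_ext tens_eq_bilin_ext)

lemma bilin_ext_append2_one [simp]:
  "bilin_ext append2 (basis_vec ([], [])) u = u" "bilin_ext append2 u (basis_vec ([], [])) = u"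
proof -
  have "append2 ([], []) p = p" "append2 p ([], []) = p" for p :: "'a list \<times> 'b list" by (cases p; simp)+
  then show "bilin_ext append2 (basis_vec ([], [])) u = u" "bilin_ext append2 u (basis_vec ([], [])) = u"
    by (simp_all add: bilin_ext_def)
qed

lemma append_phrases: "x \<in> phrases A \<Longrightarrow> y \<in> phrases A \<Longrightarrow> x @ y \<in> phrases A"
  by (simp add: phrases_def)

lemma append2_phrases:
  "p \<in> phrases A \<times> phrases A \<Longrightarrow> q \<in> phrases A \<times> phrases A \<Longrightarrow> append2 p q \<in> phrases A \<times> phrases A"
  by (cases p; cases q) (auto intro: append_phrases)

lemma unital_algebra_phrases: "unital_algebra (phrases A) phrase_mult (phrase_one :: 'a list list \<Rightarrow>\<^sub>0 'r::{comm_ring,comm_monoid_mult})"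
proof -
  have Nil: "[] \<in> phrases A" by (simp add: phrases_def)
  have "linear_map (phrases A) (phrases A) (phrase_mult p)"
    "linear_map (phrases A) (phrases A) (\<lambda>q. phrase_mult q p)"
    if "p \<in> free_mod (phrases A)" for p :: "'a list list \<Rightarrow>\<^sub>0 'r"
    using that unfolding linear_map_def phrase_mult_eq_bilin_ext
    by (auto simp: bilin_ext_add_left bilin_ext_add_right bilin_ext_smult_left bilin_ext_smult_right
        intro: free_mod_bilin_ext append_phrases)
  moreover have "phrase_mult phrase_one p = p \<and> phrase_mult p phrase_one = p"
    for p :: "'a list list \<Rightarrow>\<^sub>0 'r"
    unfolding phrase_mult_eq_bilin_ext phrase_one_def by (simp add: bilin_ext_def)
  ultimately show ?thesis
    unfolding unital_algebra_def
    by (simp add: phrase_mult_eq_bilin_ext bilin_ext_assoc phrase_one_def free_mod_basis_vec Nil)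
qed

section \<open>Homogeneous components\<close>

definition restrict_length :: "nat \<Rightarrow> ('a list \<Rightarrow>\<^sub>0 'r) \<Rightarrow> ('a list \<Rightarrow>\<^sub>0 'r::{comm_ring,comm_monoid_mult})" where
  "restrict_length m = lin_ext (\<lambda>x. if length x = m then basis_vec x else 0)"

lemma lookup_restrict_length:
  "Poly_Mapping.lookup (restrict_length m p) x = (if length x = m then Poly_Mapping.lookup p x else 0)"
proof -
  have "Poly_Mapping.lookup (restrict_length m p) x =
      (\<Sum>y\<in>Poly_Mapping.keys p. if y = x then (if length x = m then Poly_Mapping.lookup p x else 0) else 0)"
    unfolding restrict_length_def lin_ext_def lookup_sum
    by (intro sum.cong refl) (auto simp: lookup_single when_def)
  then show ?thesis by (auto simp: in_keys_iff)
qed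

text \<open>An explicit decomposition gives existence and uniqueness together, and it evaluates the
  definite description in \<open>component\<close>.\<close>

lemma decomposes_iff:
  assumes p: "p \<in> free_mod (phrases A)"
  shows "decomposes (phrase_grade A) p f \<longleftrightarrow> f = (\<lambda>m. restrict_length m p)"
proof
  assume f: "decomposes (phrase_grade A) p f"
  have zero: "Poly_Mapping.lookup (f m) x = 0" if "length x \<noteq> m" for m x
  proof -
    have "Poly_Mapping.keys (f m) \<subseteq> {x \<in> phrases A. length x = m}"
      using f by (simp add: decomposes_def phrase_grade_def free_mod_def)
    then show ?thesis using that by (auto simp: in_keys_iff)
  qed
  have "Poly_Mapping.lookup p x = Poly_Mapping.lookup (f (length x)) x" for x
  proof -
    have fin: "finite {m. f m \<noteq> 0}" and p: "p = (\<Sum>m | f m \<noteq> 0. f m)"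
      using f by (simp_all add: decomposes_def)
    have "Poly_Mapping.lookup p x = (\<Sum>m | f m \<noteq> 0. Poly_Mapping.lookup (f m) x)"
      by (subst p) (simp add: lookup_sum)
    also have "\<dots> = (\<Sum>m | f m \<noteq> 0. if m = length x then Poly_Mapping.lookup (f m) x else 0)"
      using zero by (intro sum.cong) auto
    also have "\<dots> = Poly_Mapping.lookup (f (length x)) x"
      using fin by simp
    finally show ?thesis .
  qed
  then show "f = (\<lambda>m. restrict_length m p)"
    using zero by (intro ext poly_mapping_eqI) (simp add: lookup_restrict_length)
next
  assume f: "f = (\<lambda>m. restrict_length m p)"
  have "f m \<in> phrase_grade A m" for m
    using p unfolding f phrase_grade_def free_mod_def
    by (auto simp: in_keys_iff lookup_restrict_length split: if_splits)
  moreover have sub: "{m. f m \<noteq> 0} \<subseteq> length ` Poly_Mapping.keys p"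
  proof
    fix m assume "m \<in> {m. f m \<noteq> 0}"
    then obtain x where "Poly_Mapping.lookup (f m) x \<noteq> 0"
      by (metis lookup_zero mem_Collect_eq poly_mapping_eqI)
    then have "length x = m" "x \<in> Poly_Mapping.keys p"
      by (auto simp: f lookup_restrict_length in_keys_iff split: if_splits)
    then show "m \<in> length ` Poly_Mapping.keys p" by auto
  qed
  moreover have fin: "finite {m. f m \<noteq> 0}"
    using finite_subset[OF sub] by simp
  moreover have "p = (\<Sum>m | f m \<noteq> 0. f m)"
  proof (rule poly_mapping_eqI)
    fix x
    have "(\<Sum>m | f m \<noteq> 0. Poly_Mapping.lookup (f m) x) =
        (\<Sum>m | f m \<noteq> 0. if m = length x then Poly_Mapping.lookup (f m) x else 0)"
      by (intro sum.cong) (auto simp: f lookup_restrict_length)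
    also have "\<dots> = Poly_Mapping.lookup (f (length x)) x"
      using fin by simp
    finally show "Poly_Mapping.lookup p x = Poly_Mapping.lookup (\<Sum>m | f m \<noteq> 0. f m) x"
      by (simp add: lookup_sum f lookup_restrict_length)
  qed
  ultimately show "decomposes (phrase_grade A) p f" unfolding decomposes_def by blast
qed

lemma component_eq:
  "p \<in> free_mod (phrases A) \<Longrightarrow> component (phrase_grade A) m p = restrict_length m p"
  by (simp add: component_def decomposes_iff)

lemma free_mod_le_positive_part:
  "free_mod {x \<in> phrases A. x \<noteq> []} \<subseteq> positive_part (phrase_grade A)"
proof
  fix p :: "'a list list \<Rightarrow>\<^sub>0 'b" assume p: "p \<in> free_mod {x \<in> phrases A. x \<noteq> []}"
  then have "p \<in> free_mod (phrases A)" by (auto simp: free_mod_def)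
  moreover have "restrict_length 0 p = 0"
    using p by (intro poly_mapping_eqI) (auto simp: lookup_restrict_length free_mod_def in_keys_iff)
  ultimately show "p \<in> positive_part (phrase_grade A)"
    unfolding positive_part_def by (simp add: decomposes_iff)
qed

text \<open>Reduces membership in \<open>tensor_sub\<close> to a condition on the basis pairs that
  occur; each pair contributes one elementary tensor, with the coefficient in its left
  factor.\<close>

lemma free_mod_le_tensor_sub:
  fixes U :: "('b \<Rightarrow>\<^sub>0 'r::{comm_ring,comm_monoid_mult}) set" and V :: "('c \<Rightarrow>\<^sub>0 'r) set"
  assumes "free_mod B \<subseteq> U" "free_mod C \<subseteq> V"
  shows "free_mod (B \<times> C) \<subseteq> tensor_sub U V"
proof
  fix p :: "'b \<times> 'c \<Rightarrow>\<^sub>0 'r" assume "p \<in> free_mod (B \<times> C)"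
  then show "p \<in> tensor_sub U V"
  proof (induction rule: free_mod_sum_induct)
    case zero
    show ?case unfolding tensor_sub_def by (auto intro!: exI[of _ "0::nat"])
  next
    case (add c z p)
    obtain x y where z: "z = (x, y)" "x \<in> B" "y \<in> C" using add(1) by auto
    obtain n :: nat and u v where p: "p = (\<Sum>i<n. tens (u i) (v i))" "\<forall>i<n. u i \<in> U" "\<forall>i<n. v i \<in> V"
      using add(3) unfolding tensor_sub_def mem_Collect_eq by auto
    let ?u = "u(n := smult c (basis_vec x))" and ?v = "v(n := basis_vec y)"
    have "smult c (basis_vec z) + p = (\<Sum>i<Suc n. tens (?u i) (?v i))"
      by (simp add: p z tens_smult_left tens_single add.commute)
    moreover have "\<forall>i<Suc n. ?u i \<in> U" "\<forall>i<Suc n. ?v i \<in> V"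
      using p z subsetD[OF assms(1) free_mod_smult[OF free_mod_basis_vec]] subsetD[OF assms(2) free_mod_basis_vec]
      by (auto simp: less_Suc_eq)
    ultimately show ?case unfolding tensor_sub_def by blast
  qed
qed

section \<open>The coproduct\<close>

lemma finite_cut_tokens: "[] \<notin> L \<Longrightarrow> finite (cut_tokens L w)"
  using bij_betw_finite[OF bij_betw_cut_to_tokens, of L w] finite_cuts by blast

definition word_coproduct :: "'a list set \<Rightarrow> 'a list \<Rightarrow> ('a list list \<times> 'a list list \<Rightarrow>\<^sub>0 'r::{comm_ring,comm_monoid_mult})" where
  "word_coproduct L w = (\<Sum>x\<in>word_tokens L w. basis_vec (holes x, kept_phrase x))"

fun phrase_coproduct :: "'a list set \<Rightarrow> 'a list list \<Rightarrow> ('a list list \<times> 'a list list \<Rightarrow>\<^sub>0 'r::{comm_ring,comm_monoid_mult})" where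
  "phrase_coproduct L [] = basis_vec ([], [])"
| "phrase_coproduct L (w # ws) = bilin_ext append2 (word_coproduct L w) (phrase_coproduct L ws)"

definition coproduct :: "'a list set \<Rightarrow> ('a list list \<Rightarrow>\<^sub>0 'r) \<Rightarrow> ('a list list \<times> 'a list list \<Rightarrow>\<^sub>0 'r::{comm_ring,comm_monoid_mult})" where
  "coproduct L = lin_ext (phrase_coproduct L)"

lemma phrase_coproduct_append:
  "phrase_coproduct L (x @ y) = bilin_ext append2 (phrase_coproduct L x) (phrase_coproduct L y)"
  by (induction x) (simp_all add: bilin_ext_assoc append2_assoc)

lemma sum_set_Cons: "(\<Sum>z\<in>set_Cons X Y. f z) = (\<Sum>x\<in>X. \<Sum>xs\<in>Y. f (x # xs))"
proof -
  have eq: "set_Cons X Y = (\<lambda>(x, xs). x # xs) ` (X \<times> Y)" by (auto simp: set_Cons_def)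
  have inj: "inj_on (\<lambda>(x, xs). x # xs) (X \<times> Y)" by (auto simp: inj_on_def)
  show ?thesis
    unfolding eq sum.reindex[OF inj] sum.cartesian_product by (simp add: comp_def case_prod_beta')
qed

text \<open>Distributivity: expanding the product of the sums means choosing one token list for each
  word.\<close>

lemma phrase_coproduct_sum:
  "phrase_coproduct L ws = (\<Sum>xs\<in>listset (map (word_tokens L) ws).
     basis_vec (concat (map holes xs), concat (map kept_phrase xs)))"
proof (induction ws)
  case (Cons w ws)
  then show ?case
    by (simp add: word_coproduct_def sum_set_Cons bilin_ext_sum_left bilin_ext_sum_right
        sum.swap[of _ "listset _"])
qed simp

text \<open>Leaving nothing would force \<open>[Hole w]\<close>, which is excluded. Hence
  \<open>r_c(w)\<close> is a legitimate one-word phrase for every cut.\<close>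

lemma kept_cut_tokens: "x \<in> cut_tokens L w \<Longrightarrow> w \<noteq> [] \<Longrightarrow> kept x \<noteq> []"
  using kept_Nil_separated[of x] by (auto simp: cut_tokens_def)

lemma sum_word_tokens:
  assumes "[] \<notin> L"
  shows "(\<Sum>x\<in>word_tokens L w. f x) = f [Hole w] + (\<Sum>x\<in>cut_tokens L w. f x)"
proof -
  have "[Hole w] \<notin> cut_tokens L w" by (simp add: cut_tokens_def)
  then show ?thesis by (simp add: word_tokens_def finite_cut_tokens[OF assms])
qed

lemma word_coproduct_cuts:
  assumes "[] \<notin> L" "w \<noteq> []"
  shows "word_coproduct L w = basis_vec ([w], []) + (\<Sum>c\<in>cuts L w. basis_vec (cut_left w c, [cut_right w c]))"
proof -
  have "(\<Sum>x\<in>cut_tokens L w. basis_vec (holes x, kept_phrase x)) =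
      (\<Sum>x\<in>cut_tokens L w. basis_vec (holes x, [kept x]) :: _ \<Rightarrow>\<^sub>0 'b)"
    using assms(2) by (intro sum.cong refl) (auto simp: kept_phrase_def dest: kept_cut_tokens)
  also have "\<dots> = (\<Sum>c\<in>cuts L w. basis_vec (cut_left w c, [cut_right w c]))"
    by (subst sum.reindex_bij_betw[OF bij_betw_cut_to_tokens[OF assms(1)], symmetric])
       (simp add: holes_cut_to_tokens kept_cut_to_tokens cut_right_def)
  finally show ?thesis
    by (simp add: word_coproduct_def sum_word_tokens[OF assms(1)] kept_phrase_def)
qed

lemma holes_cut_tokens:
  assumes "L \<subseteq> nonempty_words A" "x \<in> cut_tokens L w"
  shows "holes x \<in> phrases A"
  using assms by (auto simp: cut_tokens_def phrases_def)

lemma kept_cut_tokens_nonempty: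
  assumes "w \<in> nonempty_words A" "x \<in> cut_tokens L w"
  shows "kept x \<in> nonempty_words A"
  using assms kept_cut_tokens[OF assms(2)] kept_subset_flat[of x]
  by (auto simp: cut_tokens_def nonempty_words_iff)

lemma word_coproduct_free_mod:
  assumes "L \<subseteq> nonempty_words A" "w \<in> nonempty_words A"
  shows "word_coproduct L w \<in> free_mod (phrases A \<times> phrases A)"
  unfolding word_coproduct_def
proof (intro free_mod_sum free_mod_basis_vec)
  fix x assume "x \<in> word_tokens L w"
  then consider "x = [Hole w]" | "x \<in> cut_tokens L w" by (auto simp: word_tokens_def)
  then show "(holes x, kept_phrase x) \<in> phrases A \<times> phrases A"
  proof cases
    case 1
    then show ?thesis using assms(2) by (simp add: kept_phrase_def phrases_def)
  next
    case 2
    then show ?thesis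
      using holes_cut_tokens[OF assms(1) 2] kept_cut_tokens_nonempty[OF assms(2) 2]
      by (simp add: kept_phrase_def phrases_def)
  qed
qed

lemma phrase_coproduct_free_mod:
  assumes "L \<subseteq> nonempty_words A" "ws \<in> phrases A"
  shows "phrase_coproduct L ws \<in> free_mod (phrases A \<times> phrases A)"
  using assms(2)
proof (induction ws)
  case Nil
  then show ?case by (auto intro: free_mod_basis_vec simp: phrases_def)
next
  case (Cons w ws)
  then have "w \<in> nonempty_words A" "ws \<in> phrases A" by (auto simp: phrases_def)
  then show ?case
    using Cons.IH assms(1) by (auto intro: free_mod_bilin_ext word_coproduct_free_mod append2_phrases)
qed

section \<open>Existence and uniqueness of the coproduct\<close>

lemma coproduct_phrase_mult:
  "coproduct L (phrase_mult p q) = tensor_mult phrase_mult (coproduct L p) (coproduct L q)"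
  unfolding coproduct_def phrase_mult_eq_bilin_ext tensor_mult_eq_bilin_ext
  by (rule lin_ext_bilin_ext) (rule phrase_coproduct_append)

lemma cut_coproduct_coproduct:
  assumes "L \<subseteq> nonempty_words A"
  shows "cut_coproduct A L (coproduct L :: ('a list list \<Rightarrow>\<^sub>0 'r::{comm_ring,comm_monoid_mult}) \<Rightarrow> _)"
proof -
  let ?\<Delta> = "coproduct L :: ('a list list \<Rightarrow>\<^sub>0 'r) \<Rightarrow> _"
  have L: "[] \<notin> L" using assms by (auto simp: nonempty_words_def)
  have "linear_map (phrases A) (phrases A \<times> phrases A) ?\<Delta>"
    unfolding coproduct_def by (rule linear_map_lin_ext) (rule phrase_coproduct_free_mod[OF assms])
  moreover have "?\<Delta> phrase_one = tens phrase_one phrase_one"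
    by (simp add: coproduct_def phrase_one_def tens_eq_bilin_ext)
  moreover have "?\<Delta> (basis_vec [w]) = tens (basis_vec [w]) phrase_one +
      (\<Sum>c\<in>cuts L w. tens (basis_vec (cut_left w c)) (basis_vec [cut_right w c]))"
    if "w \<in> nonempty_words A" for w
    using that word_coproduct_cuts[OF L, of w]
    by (simp add: coproduct_def phrase_one_def tens_eq_bilin_ext nonempty_words_iff)
  ultimately show ?thesis
    unfolding cut_coproduct_def algebra_hom_def by (simp add: coproduct_phrase_mult)
qed

text \<open>The one-word phrases generate the algebra, so multiplicativity propagates agreement on
  words to all phrases.\<close>

lemma cut_coproduct_unique:
  assumes "cut_coproduct A L \<Delta>" "cut_coproduct A L \<Delta>'" "p \<in> free_mod (phrases A)"
  shows "\<Delta>' p = \<Delta> p"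
proof (rule linear_map_eqI[where B = "phrases A" and C = "phrases A \<times> phrases A"])
  show "linear_map (phrases A) (phrases A \<times> phrases A) \<Delta>'" "linear_map (phrases A) (phrases A \<times> phrases A) \<Delta>"
    using assms by (auto simp: cut_coproduct_def algebra_hom_def)
  show "p \<in> free_mod (phrases A)" by fact
  show "\<Delta>' (basis_vec ws) = \<Delta> (basis_vec ws)" if "ws \<in> phrases A" for ws
    using that
  proof (induction ws)
    case Nil
    have "f (basis_vec []) = tens phrase_one phrase_one" if "cut_coproduct A L f" for f
      using that unfolding cut_coproduct_def algebra_hom_def phrase_one_def by (elim conjE)
    from this[OF assms(1)] this[OF assms(2)] show ?case by simp
  next
    case (Cons w ws)
    then have w: "w \<in> nonempty_words A" and ws: "ws \<in> phrases A" by (auto simp: phrases_def)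
    have in_mod: "basis_vec [w] \<in> free_mod (phrases A)" "basis_vec ws \<in> free_mod (phrases A)"
      using w ws by (auto intro: free_mod_basis_vec simp: phrases_def)
    have mult: "f (basis_vec (w # ws)) = tensor_mult phrase_mult (f (basis_vec [w])) (f (basis_vec ws))"
      if "cut_coproduct A L f" for f
    proof -
      have "f (phrase_mult (basis_vec [w]) (basis_vec ws)) =
          tensor_mult phrase_mult (f (basis_vec [w])) (f (basis_vec ws))"
        using that in_mod unfolding cut_coproduct_def algebra_hom_def by blast
      then show ?thesis by (simp add: phrase_mult_eq_bilin_ext)
    qed
    have "\<Delta>' (basis_vec [w]) = \<Delta> (basis_vec [w])"
      using assms(1,2) w unfolding cut_coproduct_def by simp
    then show ?case unfolding mult[OF assms(1)] mult[OF assms(2)] Cons.IH[OF ws] by simp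
  qed
qed

section \<open>Coassociativity\<close>

text \<open>\<open>\<Delta> \<otimes> id\<close> on basis vectors, with the reassociation to
  \<open>(a, b, y)\<close> built in, so that it takes values in the same module as
  \<open>split_right\<close>, which is \<open>id \<otimes> \<Delta>\<close>.\<close>

definition split_left :: "'a list set \<Rightarrow> 'a list list \<times> 'a list list \<Rightarrow>
    ('a list list \<times> 'a list list \<times> 'a list list \<Rightarrow>\<^sub>0 'r::{comm_ring,comm_monoid_mult})" where
  "split_left L = (\<lambda>(x, y). lin_ext (\<lambda>(a, b). basis_vec (a, b, y)) (phrase_coproduct L x))"

definition split_right :: "'a list set \<Rightarrow> 'a list list \<times> 'a list list \<Rightarrow>
    ('a list list \<times> 'a list list \<times> 'a list list \<Rightarrow>\<^sub>0 'r::{comm_ring,comm_monoid_mult})" where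
  "split_right L = (\<lambda>(x, y). lin_ext (\<lambda>(a, b). basis_vec (x, a, b)) (phrase_coproduct L y))"

lemma split_left_append2: "split_left L (append2 p q) = bilin_ext append3 (split_left L p) (split_left L q)"
proof (cases p; cases q)
  fix x y x' y' assume p: "p = (x, y)" "q = (x', y')"
  show ?thesis
    unfolding p append2.simps split_left_def prod.case phrase_coproduct_append
    by (rule lin_ext_bilin_ext) auto
qed

lemma split_right_append2: "split_right L (append2 p q) = bilin_ext append3 (split_right L p) (split_right L q)"
proof (cases p; cases q)
  fix x y x' y' assume p: "p = (x, y)" "q = (x', y')"
  show ?thesis
    unfolding p append2.simps split_right_def prod.case phrase_coproduct_append
    by (rule lin_ext_bilin_ext) auto
qed

lemma split_left_sum: "split_left L (x, y) = (\<Sum>xs\<in>listset (map (word_tokens L) x).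
    basis_vec (concat (map holes xs), concat (map kept_phrase xs), y))"
  by (simp add: split_left_def phrase_coproduct_sum lin_ext_sum)

lemma split_right_word: "split_right L (x, [w]) = (\<Sum>z\<in>word_tokens L w. basis_vec (x, holes z, kept_phrase z))"
  by (simp add: split_right_def word_coproduct_def lin_ext_sum)

text \<open>On the left, \<open>w \<otimes> 1\<close> contributes
  \<open>\<Delta>(w) \<otimes> 1\<close>, that is \<open>w \<otimes> 1 \<otimes> 1\<close> and all
  \<open>l_c \<otimes> r_c \<otimes> 1\<close>. On the right, the former comes from
  \<open>w \<otimes> 1\<close> and the latter from the summand \<open>r_c \<otimes> 1\<close> of
  \<open>\<Delta>(r_c)\<close>. What remains is \<open>sum_nested_cuts\<close>.\<close>

lemma coassoc_word:
  assumes st: "stable A L" and w: "w \<in> nonempty_words A"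
  shows "lin_ext (split_left L) (word_coproduct L w) =
    lin_ext (split_right L) (word_coproduct L w :: _ \<Rightarrow>\<^sub>0 'r::{comm_ring,comm_monoid_mult})"
proof -
  let ?l = "split_left L :: _ \<Rightarrow> _ \<Rightarrow>\<^sub>0 'r" and ?r = "split_right L :: _ \<Rightarrow> _ \<Rightarrow>\<^sub>0 'r"
  note L = stable_Nil[OF st]
  have w': "w \<noteq> []" "set w \<subseteq> A" using w by (auto simp: nonempty_words_iff)
  have left_whole: "?l (holes [Hole w], kept_phrase [Hole w]) =
      basis_vec ([w], [], []) + (\<Sum>x\<in>cut_tokens L w. basis_vec (holes x, [kept x], []))"
  proof -
    have "(\<Sum>x\<in>cut_tokens L w. basis_vec (holes x, kept_phrase x, [])) =
        (\<Sum>x\<in>cut_tokens L w. basis_vec (holes x, [kept x], []) :: _ \<Rightarrow>\<^sub>0 'r)"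
      using kept_cut_tokens[OF _ w'(1)] by (intro sum.cong) (auto simp: kept_phrase_def)
    then show ?thesis
      by (simp add: split_left_def word_coproduct_def lin_ext_sum sum_word_tokens[OF L] kept_phrase_def lin_ext_add)
  qed
  have right_whole: "?r (holes [Hole w], kept_phrase [Hole w]) = basis_vec ([w], [], [])"
    by (simp add: split_right_def kept_phrase_def)
  have right: "?r (holes x, kept_phrase x) = basis_vec (holes x, [kept x], []) +
      (\<Sum>z\<in>cut_tokens L (kept x). basis_vec (holes x, holes z, kept_phrase z))"
    if "x \<in> cut_tokens L w" for x
    using kept_cut_tokens[OF that w'(1)]
    by (simp add: kept_phrase_def[of x] split_right_word sum_word_tokens[OF L]) (simp add: kept_phrase_def)
  have "(\<Sum>x\<in>cut_tokens L w. ?l (holes x, kept_phrase x)) =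
      (\<Sum>x\<in>cut_tokens L w. \<Sum>z\<in>cut_tokens L (kept x). basis_vec (holes x, holes z, kept_phrase z))"
    unfolding split_left_sum by (rule sum_nested_cuts[OF st w'(2)])
  then show ?thesis
    unfolding word_coproduct_def lin_ext_sum lin_ext_basis_vec
    unfolding sum_word_tokens[OF L] left_whole right_whole
    by (simp add: right sum.distrib add.assoc)
qed

text \<open>Both iterated coproducts turn \<open>append2\<close> into \<open>append3\<close>, so the
  case of one word suffices.\<close>

lemma coassoc_phrase:
  assumes st: "stable A L" and "ws \<in> phrases A"
  shows "lin_ext (split_left L) (phrase_coproduct L ws) =
    lin_ext (split_right L) (phrase_coproduct L ws :: _ \<Rightarrow>\<^sub>0 'r::{comm_ring,comm_monoid_mult})"
  using assms(2)
proof (induction ws)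
  case Nil
  then show ?case by (simp add: split_left_def split_right_def)
next
  case (Cons w ws)
  then have "w \<in> nonempty_words A" "ws \<in> phrases A" by (auto simp: phrases_def)
  moreover have "lin_ext (split_left L) (bilin_ext append2 u v) =
      bilin_ext append3 (lin_ext (split_left L) u) (lin_ext (split_left L) v)" for u v :: "_ \<Rightarrow>\<^sub>0 'r"
    by (rule lin_ext_bilin_ext) (rule split_left_append2)
  moreover have "lin_ext (split_right L) (bilin_ext append2 u v) =
      bilin_ext append3 (lin_ext (split_right L) u) (lin_ext (split_right L) v)" for u v :: "_ \<Rightarrow>\<^sub>0 'r"
    by (rule lin_ext_bilin_ext) (rule split_right_append2)
  ultimately show ?case by (simp add: coassoc_word[OF st] Cons.IH)
qed

lemma coassoc:
  fixes p :: "'a list list \<Rightarrow>\<^sub>0 'r::{comm_ring,comm_monoid_mult}"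
  assumes st: "stable A L" and "p \<in> free_mod (phrases A)"
  shows "tensor_assoc (tensor_map (coproduct L) id (coproduct L p)) = tensor_map id (coproduct L) (coproduct L p)"
proof -
  have 1: "tensor_assoc (tensor_map (coproduct L) id u) = lin_ext (split_left L) u"
    for u :: "'a list list \<times> 'a list list \<Rightarrow>\<^sub>0 'r"
    unfolding tensor_assoc_def tensor_map_def lin_ext_lin_ext
    by (intro lin_ext_cong)
       (auto simp: split_left_def coproduct_def tens_eq_bilin_ext bilin_ext_def lin_ext_lin_ext case_prod_beta')
  have 2: "tensor_map id (coproduct L) u = lin_ext (split_right L) u"
    for u :: "'a list list \<times> 'a list list \<Rightarrow>\<^sub>0 'r"
    unfolding tensor_map_def
    by (intro lin_ext_cong)
       (auto simp: split_right_def coproduct_def tens_eq_bilin_ext bilin_ext_def case_prod_beta')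
  show ?thesis
    unfolding 1 2 unfolding coproduct_def lin_ext_lin_ext
    by (rule lin_ext_cong_free_mod[OF assms(2)]) (rule coassoc_phrase[OF st])
qed

lemma graded_bialgebra_coproduct:
  assumes st: "stable A L"
  shows "graded_bialgebra (phrases A) phrase_mult phrase_one (phrase_grade A)
    (coproduct L :: ('a list list \<Rightarrow>\<^sub>0 'r::{comm_ring,comm_monoid_mult}) \<Rightarrow> _)"
proof -
  have "bialgebra (phrases A) phrase_mult phrase_one (coproduct L :: ('a list list \<Rightarrow>\<^sub>0 'r) \<Rightarrow> _)"
    using cut_coproduct_coproduct[OF stable_subset[OF st]] unital_algebra_phrases coassoc[OF st]
    unfolding bialgebra_def cut_coproduct_def by blast
  moreover have "submodule (phrases A) (phrase_grade A m :: ('a list list \<Rightarrow>\<^sub>0 'r) set)" for m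
    unfolding phrase_grade_def by (rule submodule_free_mod) auto
  moreover have "\<exists>!f. decomposes (phrase_grade A) p f" if "p \<in> free_mod (phrases A)" for p :: "'a list list \<Rightarrow>\<^sub>0 'r"
    unfolding decomposes_iff[OF that] by auto
  moreover have "(phrase_one :: 'a list list \<Rightarrow>\<^sub>0 'r) \<in> phrase_grade A 0"
    unfolding phrase_one_def phrase_grade_def by (intro free_mod_basis_vec) (simp add: phrases_def)
  moreover have "phrase_mult p q \<in> phrase_grade A (m + n)"
    if "p \<in> phrase_grade A m" "q \<in> phrase_grade A n" for p q :: "'a list list \<Rightarrow>\<^sub>0 'r" and m n
    using that unfolding phrase_grade_def phrase_mult_eq_bilin_ext
    by (rule free_mod_bilin_ext) (auto intro: append_phrases)
  ultimately show ?thesis unfolding graded_bialgebra_def by blast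
qed

section \<open>Left-handedness\<close>

lemma cut_left_right_words:
  assumes "L \<subseteq> nonempty_words A" "w \<in> nonempty_words A" "c \<in> cuts L w"
  shows "cut_left w c \<in> phrases A" "cut_right w c \<in> nonempty_words A"
proof -
  have L: "[] \<notin> L" using assms by (auto simp: nonempty_words_def)
  have "cut_to_tokens w 1 c \<in> cut_tokens L w" using bij_betw_cut_to_tokens[OF L] assms(3) by (auto simp: bij_betw_def)
  from holes_cut_tokens[OF assms(1) this] kept_cut_tokens_nonempty[OF assms(2) this]
  show "cut_left w c \<in> phrases A" "cut_right w c \<in> nonempty_words A"
    by (simp_all add: holes_cut_to_tokens kept_cut_to_tokens cut_right_def)
qed

text \<open>For a word, the two subtracted terms are \<open>w \<otimes> 1\<close> and the
  contribution \<open>1 \<otimes> w\<close> of the empty cut. Every other cut has a non-empty left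
  phrase and a one-word right phrase.\<close>

lemma left_handed_coproduct:
  fixes a :: "'a list list \<Rightarrow>\<^sub>0 'r::{comm_ring,comm_monoid_mult}"
  assumes st: "stable A L" and a: "a \<in> phrase_grade A 1"
  shows "coproduct L a - tens a phrase_one - tens phrase_one a \<in> tensor_sub (positive_part (phrase_grade A)) (phrase_grade A 1)"
proof -
  note L = stable_subset[OF st]
  let ?P = "{x \<in> phrases A. x \<noteq> []}" and ?W = "{x \<in> phrases A. length x = 1}"
  let ?d = "\<lambda>x. phrase_coproduct L x - basis_vec (x, []) - basis_vec ([], x) :: _ \<Rightarrow>\<^sub>0 'r"
  have eq: "coproduct L a - tens a phrase_one - tens phrase_one a =
      lin_ext ?d a"
    by (simp add: coproduct_def lin_ext_fun_diff tens_eq_bilin_ext phrase_one_def bilin_ext_def)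
  have "?d x \<in> free_mod (?P \<times> ?W)" if "x \<in> ?W" for x
  proof -
    obtain w where x: "x = [w]" and w: "w \<in> nonempty_words A"
      using \<open>x \<in> ?W\<close> by (auto simp: phrases_def length_Suc_conv)
    have empty: "[] \<in> cuts L w" by (simp add: cuts_def)
    have "cut_left w [] = []" "cut_right w [] = w" by (simp_all add: cut_left_def cut_right_def subword_def)
    then have d: "?d x =
        (\<Sum>c\<in>cuts L w - {[]}. basis_vec (cut_left w c, [cut_right w c]))"
      using w
      by (simp add: x nonempty_words_iff word_coproduct_cuts[OF stable_Nil[OF st]] sum.remove[OF finite_cuts empty])
    have "(basis_vec (cut_left w c, [cut_right w c]) :: _ \<Rightarrow>\<^sub>0 'r) \<in> free_mod (?P \<times> ?W)" if "c \<in> cuts L w - {[]}" for c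
      using that cut_left_right_words[OF L w, of c]
      by (intro free_mod_basis_vec) (auto simp: cut_left_def phrases_def)
    then show ?thesis unfolding d by (rule free_mod_sum)
  qed
  then have "coproduct L a - tens a phrase_one - tens phrase_one a \<in> free_mod (?P \<times> ?W)"
    unfolding eq using a unfolding phrase_grade_def by (rule free_mod_lin_ext[rotated])
  then show ?thesis
    using free_mod_le_tensor_sub[OF free_mod_le_positive_part, of ?W "phrase_grade A 1" A]
    unfolding phrase_grade_def by blast
qed

section \<open>The leading term\<close>

text \<open>The right factor of a cut always has length 1, so the projection retains exactly the
  cuts of length 1, whose pairs index the sum in \<open>rho\<close>; \<open>w \<otimes> 1\<close> is
  killed by its right factor.\<close>

lemma leading_term_word:
  assumes st: "stable A L" and w: "w \<in> nonempty_words A"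
  shows "tensor_map (component (phrase_grade A) 1) (component (phrase_grade A) 1) (word_coproduct L w) =
    tensor_map word_embed word_embed (rho L (basis_vec w) :: _ \<Rightarrow>\<^sub>0 'r::{comm_ring,comm_monoid_mult})"
proof -
  note L = stable_subset[OF st]
  let ?c = "component (phrase_grade A) 1 :: ('a list list \<Rightarrow>\<^sub>0 'r) \<Rightarrow> _"
  let ?t = "tensor_map ?c ?c"
  let ?S = "{(i, j). 1 \<le> i \<and> i < j \<and> j \<le> length w + 1 \<and> (i, j) \<noteq> (1, length w + 1) \<and> subword w i j \<in> L}"
  have comp: "?c (basis_vec x) = (if length x = 1 then basis_vec x else 0)" if "x \<in> phrases A" for x
    unfolding component_eq[OF free_mod_basis_vec[OF that]] restrict_length_def by simp
  have t: "?t (basis_vec (x, y)) = (if length x = 1 \<and> length y = 1 then basis_vec (x, y) else 0)"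
    if "x \<in> phrases A" "y \<in> phrases A" for x y
    by (simp only: tensor_map_def lin_ext_basis_vec prod.case tens_eq_bilin_ext comp[OF that(1)] comp[OF that(2)]) simp
  have ph: "[w] \<in> phrases A" "[] \<in> phrases A" using w by (simp_all add: phrases_def)
  have single: "[(i, j)] \<in> cuts L w \<longleftrightarrow> (i, j) \<in> ?S" for i j
    by (auto simp: cuts_def)
  have "?t (word_coproduct L w) =
      ?t (basis_vec ([w], [])) + (\<Sum>c\<in>cuts L w. ?t (basis_vec (cut_left w c, [cut_right w c])))"
    using w
    by (simp add: word_coproduct_cuts[OF stable_Nil[OF st]] tensor_map_def lin_ext_add lin_ext_sum nonempty_words_iff)
  also have "\<dots> = (\<Sum>c\<in>cuts L w. if length c = 1 then basis_vec (cut_left w c, [cut_right w c]) else 0)"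
  proof -
    have "?t (basis_vec (cut_left w c, [cut_right w c])) =
        (if length c = 1 then basis_vec (cut_left w c, [cut_right w c]) else 0)" if "c \<in> cuts L w" for c
      using cut_left_right_words[OF L w that] by (subst t) (simp_all add: phrases_def cut_left_def)
    moreover have "?t (basis_vec ([w], [])) = 0" using ph by (subst t) simp_all
    ultimately show ?thesis by simp
  qed
  also have "\<dots> = (\<Sum>c\<in>{c \<in> cuts L w. length c = 1}. basis_vec (cut_left w c, [cut_right w c]))"
    by (rule sum.inter_filter[symmetric]) (rule finite_cuts)
  also have "{c \<in> cuts L w. length c = 1} = (\<lambda>(i, j). [(i, j)]) ` ?S"
  proof (intro equalityI subsetI)
    fix c assume "c \<in> {c \<in> cuts L w. length c = 1}"
    then obtain i j where "c = [(i, j)]" "[(i, j)] \<in> cuts L w" by (auto simp: length_Suc_conv)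
    then show "c \<in> (\<lambda>(i, j). [(i, j)]) ` ?S" using single by (intro rev_image_eqI[of "(i, j)"]) auto
  next
    fix c assume "c \<in> (\<lambda>(i, j). [(i, j)]) ` ?S"
    then obtain i j where "c = [(i, j)]" "(i, j) \<in> ?S" by (elim imageE) (simp add: split_paired_all)
    then show "c \<in> {c \<in> cuts L w. length c = 1}" using single by simp
  qed
  also have "(\<Sum>c\<in>(\<lambda>(i, j). [(i, j)]) ` ?S. basis_vec (cut_left w c, [cut_right w c])) =
      (\<Sum>(i, j)\<in>?S. basis_vec ([subword w i j], [subword w 1 i @ subword w j (length w + 1)]))"
    by (subst sum.reindex) (auto simp: inj_on_def cut_left_def cut_right_def case_prod_beta' intro!: sum.cong)
  also have "\<dots> = tensor_map word_embed word_embed (rho L (basis_vec w))"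
    by (simp add: rho_def tensor_map_def lin_ext_sum case_prod_beta' tens_eq_bilin_ext word_embed_def)
  finally show ?thesis .
qed

lemma leading_term_coproduct:
  fixes v :: "'a list \<Rightarrow>\<^sub>0 'r::{comm_ring,comm_monoid_mult}"
  assumes st: "stable A L" and v: "v \<in> free_mod (nonempty_words A)"
  shows "leading_term (phrase_grade A) (coproduct L) (word_embed v) = tensor_map word_embed word_embed (rho L v)"
proof -
  let ?c = "component (phrase_grade A) 1 :: ('a list list \<Rightarrow>\<^sub>0 'r) \<Rightarrow> _"
  let ?t = "tensor_map ?c ?c"
  have lin: "tensor_map f g (lin_ext h p) = lin_ext (\<lambda>x. tensor_map f g (h x)) p"
    for f :: "('b \<Rightarrow>\<^sub>0 'r) \<Rightarrow> ('d \<Rightarrow>\<^sub>0 'r)" and g :: "('c \<Rightarrow>\<^sub>0 'r) \<Rightarrow> ('e \<Rightarrow>\<^sub>0 'r)" and h and p :: "'x \<Rightarrow>\<^sub>0 'r"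
    by (simp add: tensor_map_def lin_ext_lin_ext)
  have "leading_term (phrase_grade A) (coproduct L) (word_embed v) = lin_ext (\<lambda>w. ?t (word_coproduct L w)) v"
    by (simp add: leading_term_def coproduct_def word_embed_def lin_ext_lin_ext lin)
  also have "\<dots> = lin_ext (\<lambda>w. tensor_map word_embed word_embed (rho L (basis_vec w))) v"
    by (rule lin_ext_cong_free_mod[OF v]) (rule leading_term_word[OF st])
  also have "\<dots> = tensor_map word_embed word_embed (rho L v)"
    by (simp add: rho_def lin)
  finally show ?thesis .
qed

theorem theorem4p2p1:
  fixes A :: "'a set" and L :: "'a list set"
  assumes "stable A L"
  shows "\<exists>\<Delta> :: ('a list list \<Rightarrow>\<^sub>0 'r::{comm_ring,comm_monoid_mult}) \<Rightarrow> ('a list list \<times> 'a list list \<Rightarrow>\<^sub>0 'r).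
    cut_coproduct A L \<Delta> \<and>
    (\<forall>\<Delta>'. cut_coproduct A L \<Delta>' \<longrightarrow> (\<forall>p\<in>free_mod (phrases A). \<Delta>' p = \<Delta> p)) \<and>
    left_handed_graded_bialgebra (phrases A) phrase_mult phrase_one (phrase_grade A) \<Delta> \<and>
    (\<forall>v\<in>free_mod (nonempty_words A).
       leading_term (phrase_grade A) \<Delta> (word_embed v) = tensor_map word_embed word_embed (rho L v))"
proof (intro exI[of _ "coproduct L"] conjI allI impI ballI)
  show cut: "cut_coproduct A L (coproduct L)"
    by (rule cut_coproduct_coproduct[OF stable_subset[OF assms]])
  show "\<Delta>' p = coproduct L p" if "cut_coproduct A L \<Delta>'" "p \<in> free_mod (phrases A)" for \<Delta>' p
    using cut_coproduct_unique[OF cut that] .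
  show "left_handed_graded_bialgebra (phrases A) phrase_mult phrase_one (phrase_grade A) (coproduct L)"
    unfolding left_handed_graded_bialgebra_def
    using graded_bialgebra_coproduct[OF assms] left_handed_coproduct[OF assms] by blast
  show "leading_term (phrase_grade A) (coproduct L) (word_embed v) = tensor_map word_embed word_embed (rho L v)"
    if "v \<in> free_mod (nonempty_words A)" for v
    by (rule leading_term_coproduct[OF assms that])
qed

end
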